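(* Let $\mathcal{Y}'$ be a stationary random planar tessellation with convex cells and let $\mathcal{Y}$ be the column tessellation of $\mathbb{R}^3$ constructed from $\mathcal{Y}'$ and the positive cell marks $\rho_z$. Let $\lambda'_{\mathsf Z}$ be the intensity of cells of $\mathcal{Y}'$ and $\bar\rho_{\mathsf Z}=\mathbb{E}'_{\mathsf Z}(\rho_z)$ the mean mark of the typical cell of $\mathcal{Y}'$. Then the mean volume $\bar\upsilon_{\mathsf Z}$ of the typical cell of $\mathcal{Y}$ is $$\bar\upsilon_{\mathsf Z}=\frac{1}{\lambda'_{\mathsf Z}\bar\rho_{\mathsf Z}}.$$
   Context: All tessellations are stationary random tessellations whose cells are convex polytopes. All intensities are assumed to lie in $(0,\infty)$. Intensity and typical objects: the intensity of cells is the mean number of cell centroids per unit area (for the planar tessellation $\mathcal{Y}'$, lying in a horizontal plane $\mathcal{E}\cong\mathbb{R}^2$) or unit volume (for $\mathcal{Y}$); $\mathbb{E}'_{\mathsf Z}$ (resp. $\mathbb{E}_{\mathsf Z}$) is expectation with respect to the Palm distribution of the typical cell of $\mathcal{Y}'$ (resp. $\mathcal{Y}$), i.e. $\lambda_{\mathsf Z}\mathbb{E}_{\mathsf Z}[f(z)]$ is the mean of the sum of $f(z)$ over all cells $z$ with centroid in the unit cube. Column tessellation: each cell $z$ of $\mathcal{Y}'$ carries a mark $\rho_z>0$, a non-random function of $\mathcal{Y}'$ as viewed from $z$ (e.g. of the size, shape or environment of $z$). On the vertical line through the centroid of $z$ take a stationary point process of intensity $\rho_z$; given $\mathcal{Y}'$,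 the point processes on different lines are conditionally independent. The infinite vertical column with cross-section $z$ is cut by horizontal plates (translates of $z$), one through each point of the point process of $z$. The resulting tessellation of $\mathbb{R}^3$ is $\mathcal{Y}$; its cells are right prisms. *)

theory Defs
  imports "HOL-Probability.Probability"
begin

text \<open>
  Three-dimensional space is modelled as \<open>(real^2) \<times> real\<close>, so that the
  horizontal plane is the first factor and the vertical direction is the second one.
  Means are taken in the extended nonnegative reals, so that they are always meaningful.
\<close>

definition is_cell :: "'a::euclidean_space set \<Rightarrow> bool" where
  "is_cell z \<longleftrightarrow> polytope z \<and> interior z \<noteq> {}"

definition tessellation :: "'a::euclidean_space set set \<Rightarrow> bool" where
  "tessellation T \<longleftrightarrow>
     (\<forall>z\<in>T. is_cell z) \<and> \<Union>T = UNIV \<and>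
     pairwise (\<lambda>z w. interior z \<inter> interior w = {}) T \<and>
     (\<forall>K. compact K \<longrightarrow> finite {z\<in>T. z \<inter> K \<noteq> {}})"

definition translate :: "'a::euclidean_space \<Rightarrow> 'a set \<Rightarrow> 'a set" where
  "translate v z = (\<lambda>x. v + x) ` z"

definition centroid :: "'a::euclidean_space set \<Rightarrow> 'a" where
  "centroid z = (1 / measure lborel z) *\<^sub>R set_lebesgue_integral lborel z (\<lambda>x. x)"

text \<open>The hit-or-miss (Fell) \<open>\<sigma>\<close>-algebra on the cells.\<close>

definition cell_space :: "'a::euclidean_space set measure" where
  "cell_space = sigma {z. is_cell z} {{z. is_cell z \<and> z \<inter> K \<noteq> {}} | K. compact K}"

text \<open>
  The usual \<open>\<sigma>\<close>-algebra of simple point processes on a family \<open>X\<close> of subsets: the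
  counting functions of all sets in \<open>S\<close> become measurable. The finiteness guard is
  needed because \<open>card\<close> is \<open>0\<close> on infinite sets.
\<close>

definition counting_space :: "'b set set \<Rightarrow> 'b set set \<Rightarrow> 'b set measure" where
  "counting_space X S =
     sigma X {{T\<in>X. finite (T \<inter> A) \<and> card (T \<inter> A) = n} | A n. A \<in> S}"

definition tess_space :: "'a::euclidean_space set set measure" where
  "tess_space = counting_space {T. tessellation T} (sets cell_space)"

definition config_space :: "real set measure" where
  "config_space =
     counting_space {\<phi>. \<forall>K. compact K \<longrightarrow> finite (\<phi> \<inter> K)} (sets borel)"

definition stationary_random_tessellation ::
    "'w measure \<Rightarrow> ('w \<Rightarrow> 'a::euclidean_space set set) \<Rightarrow> bool" where
  "stationary_random_tessellation M Y \<longleftrightarrow>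
     prob_space M \<and> Y \<in> measurable M tess_space \<and>
     (\<forall>v. distr M tess_space (\<lambda>\<omega>. translate v ` Y \<omega>) = distr M tess_space Y)"

definition unit_cube :: "'a::euclidean_space set" where
  "unit_cube = {x. \<forall>i\<in>Basis. 0 \<le> x \<bullet> i \<and> x \<bullet> i < 1}"

definition cell_intensity ::
    "'w measure \<Rightarrow> ('w \<Rightarrow> 'a::euclidean_space set set) \<Rightarrow> ennreal" where
  "cell_intensity M Y =
     (\<integral>\<^sup>+\<omega>. emeasure (count_space UNIV) {z \<in> Y \<omega>. centroid z \<in> unit_cube} \<partial>M)"

text \<open>
  Palm expectation for the typical cell. The functional \<open>f\<close> may depend on the cell and
  on the tessellation around it (it is meant to be invariant under joint translations).
\<close>

definition typical_cell_mean ::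
    "'w measure \<Rightarrow> ('w \<Rightarrow> 'a::euclidean_space set set) \<Rightarrow>
      ('a set set \<Rightarrow> 'a set \<Rightarrow> ennreal) \<Rightarrow> ennreal" where
  "typical_cell_mean M Y f =
     (\<integral>\<^sup>+\<omega>. (\<integral>\<^sup>+z. f (Y \<omega>) z \<partial>count_space {z \<in> Y \<omega>. centroid z \<in> unit_cube}) \<partial>M)
       / cell_intensity M Y"

definition cell_mark ::
    "('a::euclidean_space set set \<Rightarrow> 'a set \<Rightarrow> real) \<Rightarrow> bool" where
  "cell_mark \<rho> \<longleftrightarrow>
     (\<lambda>(T, z). \<rho> T z) \<in> borel_measurable (tess_space \<Otimes>\<^sub>M cell_space) \<and>
     (\<forall>T z. tessellation T \<and> z \<in> T \<longrightarrow> 0 < \<rho> T z) \<and>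
     (\<forall>T z v. tessellation T \<and> z \<in> T \<longrightarrow> \<rho> (translate v ` T) (translate v z) = \<rho> T z)"

text \<open>
  The conditional law of the point processes given \<open>Y'\<close> is expressed through cells that are
  selected as a measurable function of \<open>Y'\<close>: given \<open>Y'\<close>, such a cell is fixed.
\<close>

definition cell_selector :: "('a::euclidean_space set set \<Rightarrow> 'a set) \<Rightarrow> bool" where
  "cell_selector g \<longleftrightarrow>
     g \<in> measurable tess_space cell_space \<and> (\<forall>T. tessellation T \<longrightarrow> g T \<in> T)"

definition generated_by ::
    "'w measure \<Rightarrow> ('w \<Rightarrow> 'a::euclidean_space set set) \<Rightarrow> 'w measure" where
  "generated_by M Y = vimage_algebra (space M) Y tess_space"

text \<open>
  \<open>\<Phi> \<omega> z\<close> is the set of heights of the points on the vertical line through the centroid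
  of the cell \<open>z\<close> of \<open>Y' \<omega>\<close>; its values for sets that are not cells of \<open>Y' \<omega>\<close> play
  no role. Configurations are sets, so the point processes are simple: every point gives
  rise to one plate.
\<close>

definition line_processes ::
    "'w measure \<Rightarrow> ('w \<Rightarrow> 'a::euclidean_space set set) \<Rightarrow>
      ('a set set \<Rightarrow> 'a set \<Rightarrow> real) \<Rightarrow> ('w \<Rightarrow> 'a set \<Rightarrow> real set) \<Rightarrow> bool" where
  "line_processes M Y' \<rho> \<Phi> \<longleftrightarrow>
     (\<forall>g. cell_selector g \<longrightarrow>
        (\<lambda>\<omega>. \<Phi> \<omega> (g (Y' \<omega>))) \<in> measurable M config_space) \<and>
     (\<forall>g t. \<forall>A\<in>sets config_space. cell_selector g \<longrightarrow>
        (AE \<omega> in M.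
           nn_cond_exp M (generated_by M Y')
             (\<lambda>\<omega>. indicator A (translate t (\<Phi> \<omega> (g (Y' \<omega>))))) \<omega> =
           nn_cond_exp M (generated_by M Y')
             (\<lambda>\<omega>. indicator A (\<Phi> \<omega> (g (Y' \<omega>)))) \<omega>)) \<and>
     (\<forall>g. cell_selector g \<longrightarrow>
        (AE \<omega> in M.
           nn_cond_exp M (generated_by M Y')
             (\<lambda>\<omega>. emeasure (count_space UNIV) (\<Phi> \<omega> (g (Y' \<omega>)) \<inter> {0..<1})) \<omega> =
           ennreal (\<rho> (Y' \<omega>) (g (Y' \<omega>))))) \<and>
     (\<forall>G A. finite G \<and> (\<forall>g\<in>G. cell_selector g \<and> A g \<in> sets config_space) \<and>
        pairwise (\<lambda>g h. \<forall>T. tessellation T \<longrightarrow> g T \<noteq> h T) G \<longrightarrow>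
        (AE \<omega> in M.
           nn_cond_exp M (generated_by M Y')
             (\<lambda>\<omega>. \<Prod>g\<in>G. indicator (A g) (\<Phi> \<omega> (g (Y' \<omega>)))) \<omega> =
           (\<Prod>g\<in>G. nn_cond_exp M (generated_by M Y')
             (\<lambda>\<omega>. indicator (A g) (\<Phi> \<omega> (g (Y' \<omega>)))) \<omega>)))"

text \<open>
  The cells are the parts of the columns \<open>z \<times> UNIV\<close> between two consecutive plates
  \<open>z \<times> {a}\<close> and \<open>z \<times> {b}\<close>. Only bounded parts are listed; whenever the result is a
  tessellation, every column is covered by them and no unbounded part exists.
\<close>

definition column_tessellation ::
    "'a::euclidean_space set set \<Rightarrow> ('a set \<Rightarrow> real set) \<Rightarrow> ('a \<times> real) set set" where
  "column_tessellation T \<phi> =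
     {z \<times> {a..b} | z a b.
        z \<in> T \<and> a \<in> \<phi> z \<and> b \<in> \<phi> z \<and> a < b \<and> \<phi> z \<inter> {a<..<b} = {}}"

end

theory Submission
  imports Defs
begin

text \<open>
  Stationarity of \<open>Y\<close> yields a mass transport principle over the integer lattice. Sending the
  volume of each cell from the unit cube containing its centroid to the unit cubes the cell meets
  shows that the intensity times the mean cell volume is the volume of the unit cube, so the mean
  volume is the reciprocal of the intensity of \<open>Y\<close>. Sending unit mass from the centroid of a
  prism to the point of its bottom facet below the centroid shows that this intensity also counts
  the bottom facets, i.e. the plates: a column over the cell \<open>z\<close> contributes the points of
  \<open>\<Phi> \<omega> z\<close> in \<open>{0..<1}\<close>, whose conditional mean given \<open>Y'\<close> is \<open>\<rho> z\<close>. To use this conditional mean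
  cell by cell, the cells of \<open>Y'\<close> are enumerated by countably many measurable selectors attached
  to a dense sequence of points.
\<close>

subsection \<open>The space of cells\<close>

lemma is_cellD:
  assumes "is_cell z"
  shows "polytope z" "interior z \<noteq> {}" "compact z" "closed z" "convex z" "bounded z" "z \<noteq> {}"
    "z \<in> sets borel" "closure (interior z) = z"
proof -
  show *: "polytope z" "interior z \<noteq> {}"
    using assms by (auto simp: is_cell_def)
  show "compact z" "closed z" "convex z" "bounded z"
    using * by (auto simp: polytope_imp_compact polytope_imp_closed polytope_imp_convex polytope_imp_bounded)
  then show "z \<in> sets borel" "closure (interior z) = z"
    using * by (auto simp: convex_closure_interior)
  show "z \<noteq> {}" using * by auto
qed

section \<open>Translations of sets and of cells\<close>

lemma translate_eq_plus_image: "translate v = (`) ((+) v)"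
  by (auto simp: translate_def fun_eq_iff)

lemma mem_translate: "x \<in> translate v z \<longleftrightarrow> x - v \<in> z"
  unfolding translate_def by (auto intro!: image_eqI[of _ _ "x - v"])

lemma translate_translate: "translate v (translate w z) = translate (v + w) z"
  by (auto simp: set_eq_iff mem_translate algebra_simps)

lemma translate_0 [simp]: "translate 0 z = z"
  by (auto simp: set_eq_iff mem_translate)

lemma translate_minus_cancel [simp]:
  "translate v (translate (- v) z) = z" "translate (- v) (translate v z) = z"
  by (simp_all add: translate_translate)

lemma inj_translate: "inj (translate v)"
  by (metis injI translate_minus_cancel(2))

lemma translate_Int: "translate v (A \<inter> B) = translate v A \<inter> translate v B"
  by (auto simp: mem_translate)

lemma translate_Int_empty_iff:
  "translate v z \<inter> K = {} \<longleftrightarrow> z \<inter> translate (- v) K = {}"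
proof -
  have "translate v z \<inter> K = translate v (z \<inter> translate (- v) K)"
    by (simp add: translate_Int)
  then show ?thesis unfolding translate_eq_plus_image by (metis image_is_empty)
qed

lemma interior_translate: "interior (translate v z) = translate v (interior z)"
  by (simp add: translate_eq_plus_image interior_translation)

lemma compact_translate: "compact K \<Longrightarrow> compact (translate v K)"
  by (simp add: translate_eq_plus_image compact_translation)

lemma is_cell_translate:
  assumes "is_cell z" shows "is_cell (translate v z)"
proof -
  obtain V where V: "finite V" "z = convex hull V"
    using assms by (auto simp: is_cell_def polytope_def)
  then have "translate v z = convex hull ((+) v ` V)"
    by (simp add: translate_eq_plus_image convex_hull_translation)
  then have "polytope (translate v z)"
    using V(1) by (auto simp: polytope_def)
  moreover have "interior (translate v z) \<noteq> {}"
    using is_cellD(2)[OF assms]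
    by (simp only: interior_translate) (simp add: translate_eq_plus_image)
  ultimately show ?thesis by (simp add: is_cell_def)
qed

section \<open>Measurable events in the hit-or-miss space of cells\<close>

lemma space_cell_space [simp]: "space cell_space = {z. is_cell z}"
  unfolding cell_space_def by (rule space_measure_of) auto

lemma sets_cell_space_hit:
  assumes "compact K" shows "{z. is_cell z \<and> z \<inter> K \<noteq> {}} \<in> sets cell_space"
  unfolding cell_space_def by (subst sets_measure_of) (use assms in \<open>auto intro: sigma_sets.Basic\<close>)

text \<open>A closed set is the countable union of its compact intersections with the balls
  \<open>cball 0 n\<close>. This makes half-spaces available as test sets.\<close>

lemma sets_cell_space_hit_closed:
  assumes "closed C" shows "{z. is_cell z \<and> z \<inter> C \<noteq> {}} \<in> sets cell_space"
proof -
  have "{z. is_cell z \<and> z \<inter> C \<noteq> {}} = (\<Union>n::nat. {z. is_cell z \<and> z \<inter> (C \<inter> cball 0 (real n)) \<noteq> {}})"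
  proof (intro set_eqI iffI)
    fix z assume z: "z \<in> {z. is_cell z \<and> z \<inter> C \<noteq> {}}"
    then obtain x where x: "x \<in> z" "x \<in> C" by auto
    obtain n :: nat where "norm x \<le> n" using real_arch_simple by blast
    with x have "x \<in> z \<inter> (C \<inter> cball 0 (real n))" by simp
    with z show "z \<in> (\<Union>n::nat. {z. is_cell z \<and> z \<inter> (C \<inter> cball 0 (real n)) \<noteq> {}})"
      by blast
  qed auto
  also have "\<dots> \<in> sets cell_space"
    using assms by (intro sets.countable_UN) (auto intro!: sets_cell_space_hit closed_Int_compact)
  finally show ?thesis .
qed

text \<open>It suffices to look at the generators: the translated cell hits \<open>K\<close> exactly
  when the cell hits \<open>K\<close> shifted back.\<close>

lemma measurable_translate_cell:
  "translate v \<in> measurable cell_space (cell_space :: 'a::euclidean_space set measure)"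
proof -
  have "translate v -` {z. is_cell z \<and> z \<inter> K \<noteq> {}} \<inter> space cell_space \<in> sets cell_space"
    if "compact K" for K :: "'a set"
  proof -
    have "translate v -` {z. is_cell z \<and> z \<inter> K \<noteq> {}} \<inter> space cell_space
        = {z. is_cell z \<and> z \<inter> translate (- v) K \<noteq> {}}"
      by (auto simp: is_cell_translate translate_Int_empty_iff)
    then show ?thesis using that by (simp add: sets_cell_space_hit compact_translate)
  qed
  then have "translate v \<in> measurable cell_space
      (sigma {z. is_cell z} {{z. is_cell z \<and> z \<inter> K \<noteq> {}} | K :: 'a set. compact K})"
    by (intro measurable_measure_of) (auto intro!: is_cell_translate)
  then show ?thesis unfolding cell_space_def[symmetric] .
qed

lemma pred_mem_cell: "Measurable.pred cell_space (\<lambda>z. x \<in> z)"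
proof -
  have "{z \<in> space cell_space. x \<in> z} = {z. is_cell z \<and> z \<inter> {x} \<noteq> {}}" by auto
  also have "\<dots> \<in> sets cell_space" by (intro sets_cell_space_hit) simp
  finally show ?thesis by (simp add: Measurable.pred_def)
qed

lemma dense_sequence:
  obtains q :: "nat \<Rightarrow> 'a::second_countable_topology"
  where "\<And>U. open U \<Longrightarrow> U \<noteq> {} \<Longrightarrow> \<exists>n. q n \<in> U"
proof -
  obtain D :: "'a set" where D: "countable D" "\<And>U. open U \<Longrightarrow> U \<noteq> {} \<Longrightarrow> \<exists>d\<in>D. d \<in> U"
    by (rule countable_dense_setE) blast
  have "D \<noteq> {}" using D(2)[of UNIV] by auto
  have "\<exists>n. from_nat_into D n \<in> U" if U: "open U" "U \<noteq> {}" for U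
  proof -
    obtain d where d: "d \<in> D" "d \<in> U" using D(2)[OF U] by blast
    then obtain n where "from_nat_into D n = d" using from_nat_into_surj[OF D(1)] by metis
    with d show ?thesis by metis
  qed
  then show ?thesis by (rule that)
qed

text \<open>Lying in the interior is not a hitting event, so it is reduced to countably many
  memberships: since \<open>z\<close> is closed, a ball lies in \<open>z\<close> once all its points
  from a dense sequence do.\<close>

lemma pred_mem_interior_cell:
  "Measurable.pred cell_space (\<lambda>z. x \<in> interior (z :: 'a::euclidean_space set))"
proof -
  obtain q :: "nat \<Rightarrow> 'a" where q: "\<And>U. open U \<Longrightarrow> U \<noteq> {} \<Longrightarrow> \<exists>n. q n \<in> U"
    using dense_sequence by metis
  have "x \<in> interior z \<longleftrightarrow> (\<exists>k::nat. \<forall>n. q n \<in> ball x (1 / Suc k) \<longrightarrow> q n \<in> z)" if "is_cell z" for z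
  proof
    assume "x \<in> interior z"
    then obtain e where e: "e > 0" "ball x e \<subseteq> z"
      by (meson mem_interior)
    then obtain k where "1 / Suc k < e" using nat_approx_posE by metis
    then have "ball x (1 / Suc k) \<subseteq> z" using e by (meson subset_ball less_imp_le order_trans)
    then show "\<exists>k::nat. \<forall>n. q n \<in> ball x (1 / Suc k) \<longrightarrow> q n \<in> z" by blast
  next
    assume "\<exists>k::nat. \<forall>n. q n \<in> ball x (1 / Suc k) \<longrightarrow> q n \<in> z"
    then obtain k :: nat where k: "\<And>n. q n \<in> ball x (1 / Suc k) \<Longrightarrow> q n \<in> z" by blast
    \<comment> \<open>This difference is open because \<open>z\<close> is closed; were it nonempty,
      the dense sequence would have a point in it.\<close>
    have "ball x (1 / Suc k) - z = {}"
    proof (rule ccontr)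
      assume "ball x (1 / Suc k) - z \<noteq> {}"
      with q[of "ball x (1 / Suc k) - z"] is_cellD(4)[OF that] k show False
        by (auto simp: open_Diff)
    qed
    then show "x \<in> interior z"
      by (intro interiorI[of "ball x (1 / Suc k)"]) (auto simp del: of_nat_Suc)
  qed
  then have "Measurable.pred cell_space (\<lambda>z. x \<in> interior z) \<longleftrightarrow>
     Measurable.pred cell_space (\<lambda>z. \<exists>k::nat. \<forall>n. q n \<in> ball x (1 / Suc k) \<longrightarrow> q n \<in> z)"
    by (intro measurable_cong) auto
  also have "\<dots>"
    by (intro pred_intros_countable pred_intros_logic pred_mem_cell measurable_const) auto
  finally show ?thesis .
qed

text \<open>Joint measurability is what makes integrals over a variable cell measurable in the cell.
  Membership in a closed set is approximated by small balls around dense points that both hit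
  \<open>z\<close> and contain \<open>x\<close>; each such condition is a measurable
  rectangle.\<close>

lemma pred_mem_cell_pair:
  "Measurable.pred (cell_space \<Otimes>\<^sub>M borel) (\<lambda>(z, x :: 'a::euclidean_space). x \<in> z)"
proof -
  obtain q :: "nat \<Rightarrow> 'a" where q: "\<And>U. open U \<Longrightarrow> U \<noteq> {} \<Longrightarrow> \<exists>n. q n \<in> U"
    using dense_sequence by metis
  define P where "P k n = (\<lambda>(z, x). z \<inter> cball (q n) (1 / Suc k) \<noteq> {} \<and> x \<in> cball (q n) (1 / Suc k))"
    for k n :: nat
  have "x \<in> z \<longleftrightarrow> (\<forall>k. \<exists>n. P k n (z, x))" if "is_cell z" for z x
  proof
    assume "x \<in> z"
    show "\<forall>k. \<exists>n. P k n (z, x)"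
    proof
      fix k
      obtain n where "q n \<in> ball x (1 / Suc k)"
        using q[of "ball x (1 / Suc k)"] by (auto simp del: of_nat_Suc)
      then have "x \<in> cball (q n) (1 / Suc k)" by (simp add: dist_commute)
      with \<open>x \<in> z\<close> have "P k n (z, x)" by (auto simp: P_def simp del: mem_cball)
      then show "\<exists>n. P k n (z, x)" by blast
    qed
  next
    assume P: "\<forall>k. \<exists>n. P k n (z, x)"
    have "\<exists>y\<in>z. dist y x < e" if "e > 0" for e
    proof -
      obtain k where k: "1 / Suc k < e / 2" using nat_approx_posE[of "e / 2"] \<open>e > 0\<close> by (metis half_gt_zero)
      from P obtain n where "P k n (z, x)" by blast
      then obtain y where "y \<in> z" "dist (q n) y \<le> 1 / Suc k" "dist (q n) x \<le> 1 / Suc k"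
        by (auto simp: P_def simp del: of_nat_Suc)
      then show ?thesis using k dist_triangle[of y x "q n"]
        by (intro bexI[of _ y]) (auto simp: dist_commute simp del: of_nat_Suc)
    qed
    then have "x \<in> closure z" by (simp add: closure_approachable)
    then show "x \<in> z" using is_cellD(4)[OF that] by simp
  qed
  then have "(case zx of (z, x :: 'a) \<Rightarrow> x \<in> z) \<longleftrightarrow> (\<forall>k. \<exists>n. P k n zx)"
    if "zx \<in> space (cell_space \<Otimes>\<^sub>M borel)" for zx
    using that by (cases zx) (simp add: space_pair_measure)
  then have "Measurable.pred (cell_space \<Otimes>\<^sub>M borel) (\<lambda>(z, x :: 'a). x \<in> z) \<longleftrightarrow>
     Measurable.pred (cell_space \<Otimes>\<^sub>M borel) (\<lambda>zx. \<forall>k. \<exists>n. P k n zx)"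
    by (intro measurable_cong)
  also have "\<dots>"
  proof (intro pred_intros_countable)
    fix k n
    have "{zx \<in> space (cell_space \<Otimes>\<^sub>M borel). P k n zx} =
       {z. is_cell z \<and> z \<inter> cball (q n) (1 / Suc k) \<noteq> {}} \<times> cball (q n) (1 / Suc k)"
      by (auto simp: P_def space_pair_measure)
    also have "\<dots> \<in> sets (cell_space \<Otimes>\<^sub>M borel)"
      by (intro pair_measureI sets_cell_space_hit) auto
    finally show "Measurable.pred (cell_space \<Otimes>\<^sub>M borel) (P k n)"
      by (simp add: Measurable.pred_def)
  qed
  finally show ?thesis .
qed

section \<open>Volume, centroid and bottom height as functionals of a cell\<close>

lemma measurable_indicator_cell_pair:
  "(\<lambda>(z, x :: 'a::euclidean_space). indicator z x) \<in>
     measurable (cell_space \<Otimes>\<^sub>M lborel) (borel :: 'b::{topological_space,zero_neq_one} measure)"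
proof -
  have "(\<lambda>zx. if (case zx of (z, x :: 'a) \<Rightarrow> x \<in> z) then 1 else 0) \<in>
     measurable (cell_space \<Otimes>\<^sub>M borel) (borel :: 'b measure)"
    by (intro measurable_If measurable_const pred_mem_cell_pair[THEN predE]) auto
  also have "(\<lambda>zx. if (case zx of (z, x :: 'a) \<Rightarrow> x \<in> z) then 1 else 0) = (\<lambda>(z, x). indicator z x :: 'b)"
    by (auto simp: fun_eq_iff)
  finally show ?thesis
    by (simp cong: measurable_cong_sets)
qed

text \<open>The volume is a parametrised integral of the jointly measurable indicator. The identity
  uses that cells are Borel, so it is invoked only on the space of cells.\<close>

lemma measurable_emeasure_cell_Int:
  assumes C: "(C :: 'a::euclidean_space set) \<in> sets borel"
  shows "(\<lambda>z. emeasure lborel (z \<inter> C)) \<in> borel_measurable cell_space"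
proof -
  have [measurable]: "(\<lambda>(z, x :: 'a). indicator z x :: ennreal) \<in> borel_measurable (cell_space \<Otimes>\<^sub>M lborel)"
    by (rule measurable_indicator_cell_pair)
  note C [measurable]
  have "(\<lambda>z. \<integral>\<^sup>+x. indicator z x * indicator C x \<partial>lborel) \<in> borel_measurable cell_space"
    by measurable
  moreover have "emeasure lborel (z \<inter> C) = (\<integral>\<^sup>+x. indicator z x * indicator C x \<partial>lborel)"
    if "is_cell z" for z
    using C is_cellD(8)[OF that] by (simp flip: indicator_inter_arith)
  ultimately show ?thesis
    by (subst measurable_cong[where g = "\<lambda>z. \<integral>\<^sup>+x. indicator z x * indicator C x \<partial>lborel"]) auto
qed

text \<open>A nonempty open set is not negligible, and a bounded set has finite volume. This makes
  the division in \<open>centroid\<close> meaningful.\<close>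

lemma emeasure_cell_pos_finite:
  assumes "is_cell z"
  shows "0 < measure lborel z" "emeasure lborel z = ennreal (measure lborel z)"
proof -
  show *: "emeasure lborel z = ennreal (measure lborel z)"
    using emeasure_bounded_finite[OF is_cellD(6)[OF assms]] by (simp add: emeasure_eq_ennreal_measure)
  have "negligible z \<Longrightarrow> False"
    using is_cellD(2)[OF assms] negligible_subset[OF _ interior_subset] open_not_negligible by blast
  then have "z \<notin> null_sets lborel"
    using is_cellD(8)[OF assms]
    by (auto simp: negligible_iff_null_sets null_sets_completion_iff)
  then have "emeasure lborel z \<noteq> 0"
    using is_cellD(8)[OF assms] by auto
  then show "0 < measure lborel z"
    by (metis * ennreal_0 measure_nonneg order_less_le)
qed

lemma measurable_centroid: "centroid \<in> borel_measurable (cell_space :: 'a::euclidean_space set measure)"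
proof -
  have [measurable]: "(\<lambda>(z, x :: 'a). indicator z x :: real) \<in> borel_measurable (cell_space \<Otimes>\<^sub>M lborel)"
    by (rule measurable_indicator_cell_pair)
  have [measurable]: "(\<lambda>z :: 'a set. measure lborel z) \<in> borel_measurable cell_space"
    using measurable_emeasure_cell_Int[of "UNIV :: 'a set"] unfolding measure_def by simp
  have "(\<lambda>z. (1 / measure lborel z) *\<^sub>R (LINT x|lborel. indicator z x *\<^sub>R (x :: 'a)))
      \<in> borel_measurable cell_space"
    by measurable
  then show ?thesis
    by (simp add: centroid_def[abs_def] set_lebesgue_integral_def)
qed

lemma integrable_cell:
  fixes f :: "_ \<Rightarrow> 'b::{banach, second_countable_topology}"
  assumes "is_cell z" "continuous_on z f"
  shows "integrable lborel (\<lambda>x. indicator z x *\<^sub>R f x)"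
  using borel_integrable_compact[OF is_cellD(3)[OF assms(1)] assms(2)] .

lemma sets_borel_translate:
  assumes "A \<in> sets borel" shows "translate v A \<in> sets borel"
proof -
  have "translate v A = (\<lambda>x. x - v) -` A \<inter> space borel"
    by (auto simp: mem_translate)
  also have "\<dots> \<in> sets borel"
    by (rule measurable_sets[OF _ assms]) measurable
  finally show ?thesis .
qed

lemma emeasure_lborel_translate:
  assumes "A \<in> sets borel" shows "emeasure lborel (translate v A) = emeasure lborel A"
proof -
  have "emeasure lborel (translate v A) = emeasure (distr lborel borel ((+) v)) (translate v A)"
    by (simp only: lborel_distr_plus)
  also have "\<dots> = emeasure lborel ((+) v -` translate v A \<inter> space lborel)"
    using sets_borel_translate[OF assms] by (subst emeasure_distr) auto
  also have "(+) v -` translate v A \<inter> space lborel = A"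
    by (auto simp: mem_translate)
  finally show ?thesis .
qed

text \<open>Changing variables adds the volume times \<open>v\<close> to the integral; after
  division by the positive volume this is \<open>v\<close>.\<close>

lemma centroid_translate:
  assumes "is_cell z" shows "centroid (translate v z) = v + centroid z"
proof -
  have "(LINT x|lborel. indicator (translate v z) x *\<^sub>R x)
      = (LINT x|distr lborel borel ((+) v). indicator (translate v z) x *\<^sub>R x)"
    by (simp only: lborel_distr_plus)
  also have "\<dots> = (LINT x|lborel. indicator (translate v z) (v + x) *\<^sub>R (v + x))"
    using is_cellD(8)[OF is_cell_translate[OF assms]] by (subst integral_distr) auto
  also have "\<dots> = (LINT x|lborel. indicator z x *\<^sub>R v + indicator z x *\<^sub>R x)"
    by (intro Bochner_Integration.integral_cong)
       (auto simp: indicator_def mem_translate scaleR_add_right)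
  also have "\<dots> = (LINT x|lborel. indicator z x *\<^sub>R v) + (LINT x|lborel. indicator z x *\<^sub>R x)"
    by (intro Bochner_Integration.integral_add integrable_cell[OF assms]) (auto intro: continuous_intros)
  also have "(LINT x|lborel. indicator z x *\<^sub>R v) = measure lborel z *\<^sub>R v"
    using is_cellD(8)[OF assms] emeasure_cell_pos_finite[OF assms] by simp
  finally show ?thesis
    using emeasure_cell_pos_finite[OF assms, unfolded measure_def]
    by (simp add: centroid_def set_lebesgue_integral_def measure_def emeasure_lborel_translate is_cellD(8)[OF assms] scaleR_add_right)
qed

text \<open>The infimum is attained on a compact cell, so it is at most \<open>t\<close> exactly
  when the cell hits a closed lower half-space. It will serve as the height of the bottom facet of a
  prism.\<close>

lemma measurable_Inf_height:
  "(\<lambda>z. Inf (snd ` z)) \<in> borel_measurable (cell_space :: ('a::euclidean_space \<times> real) set measure)"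
proof (rule borel_measurable_iff_le[THEN iffD2], rule allI)
  fix t :: real
  have "Inf (snd ` z) \<le> t \<longleftrightarrow> z \<inter> (UNIV \<times> {..t}) \<noteq> {}" if "is_cell z" for z :: "('a \<times> real) set"
  proof -
    have "compact (snd ` z)" "snd ` z \<noteq> {}"
      using is_cellD(3,7)[OF that] by (auto intro!: compact_continuous_image continuous_intros)
    then obtain s where "s \<in> snd ` z" "\<And>u. u \<in> snd ` z \<Longrightarrow> s \<le> u"
      using compact_attains_inf by metis
    moreover from this have "Inf (snd ` z) = s" by (intro cInf_eq_minimum)
    ultimately show ?thesis by force
  qed
  then have "{z \<in> space cell_space. Inf (snd ` z) \<le> t} =
      {z :: ('a \<times> real) set. is_cell z \<and> z \<inter> (UNIV \<times> {..t}) \<noteq> {}}" by auto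
  also have "\<dots> \<in> sets cell_space"
    by (intro sets_cell_space_hit_closed closed_Times) auto
  finally show "{z :: ('a \<times> real) set \<in> space cell_space. Inf (snd ` z) \<le> t} \<in> sets cell_space" .
qed

lemma Inf_height_translate:
  assumes "is_cell (z :: ('a::euclidean_space \<times> real) set)"
  shows "Inf (snd ` translate v z) = snd v + Inf (snd ` z)"
proof -
  have "compact (snd ` z)" "snd ` z \<noteq> {}"
    using is_cellD(3,7)[OF assms] by (auto intro!: compact_continuous_image continuous_intros)
  then obtain s where s: "s \<in> snd ` z" "\<And>u. u \<in> snd ` z \<Longrightarrow> s \<le> u"
    using compact_attains_inf by metis
  then have "Inf (snd ` z) = s" by (intro cInf_eq_minimum)
  moreover have "Inf (snd ` translate v z) = snd v + s"
  proof (rule cInf_eq_minimum)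
    have *: "snd ` translate v z = (+) (snd v) ` snd ` z"
      by (simp add: translate_def image_image)
    show "snd v + s \<in> snd ` translate v z" using s(1) unfolding * by (rule imageI)
    show "snd v + s \<le> u" if u: "u \<in> snd ` translate v z" for u
    proof -
      obtain w where "u = snd v + w" "w \<in> snd ` z" using u unfolding * by (rule imageE)
      then show ?thesis using s(2) by simp
    qed
  qed
  ultimately show ?thesis by simp
qed

subsection \<open>Stationary tessellations and mass transport\<close>

lemma space_counting_space: "space (counting_space X S) = X"
  unfolding counting_space_def by (rule space_measure_of) auto

lemma sets_counting_space_card:
  assumes "A \<in> S"
  shows "{T \<in> X. finite (T \<inter> A) \<and> card (T \<inter> A) = n} \<in> sets (counting_space X S)"
  unfolding counting_space_def
  by (subst sets_measure_of) (use assms in \<open>auto intro!: sigma_sets.Basic\<close>)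

lemma measurable_emeasure_count_Int:
  assumes "A \<in> S"
  shows "(\<lambda>T. emeasure (count_space UNIV) (T \<inter> A)) \<in> borel_measurable (counting_space X S)"
proof -
  let ?C = "counting_space X S"
  have eq: "{T \<in> space ?C. finite (T \<inter> A)} = (\<Union>n. {T \<in> X. finite (T \<inter> A) \<and> card (T \<inter> A) = n})"
    by (auto simp: space_counting_space)
  have fin: "{T \<in> space ?C. finite (T \<inter> A)} \<in> sets ?C"
    unfolding eq using assms by (intro sets.countable_UN) (auto intro: sets_counting_space_card)
  have "(\<lambda>T. card (T \<inter> A)) -` {n} \<inter> space ?C \<in> sets ?C" for n
  proof -
    \<comment> \<open>Infinite intersections also have \<open>card\<close> equal to 0, so the level
      \<open>n = 0\<close> consists of the empty and the infinite ones.\<close>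
    have "(\<lambda>T. card (T \<inter> A)) -` {n} \<inter> space ?C = {T \<in> X. finite (T \<inter> A) \<and> card (T \<inter> A) = n} \<union>
      (if n = 0 then space ?C - {T \<in> space ?C. finite (T \<inter> A)} else {})"
      by (auto simp: space_counting_space card_ge_0_finite)
    then show ?thesis
      using fin sets_counting_space_card[OF assms] by auto
  qed
  then have "(\<lambda>T. card (T \<inter> A)) \<in> measurable ?C (count_space UNIV)"
    by (subst measurable_count_space_eq2_countable) auto
  then have "(\<lambda>T. of_nat (card (T \<inter> A)) :: ennreal) \<in> borel_measurable ?C"
    by (rule measurable_compose) simp
  then have "(\<lambda>T. if finite (T \<inter> A) then of_nat (card (T \<inter> A)) else \<infinity> :: ennreal) \<in> borel_measurable ?C"
    using fin by (intro measurable_If) auto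
  then show ?thesis by (simp add: emeasure_count_space)
qed

lemma space_tess_space [simp]: "space tess_space = {T. tessellation T}"
  unfolding tess_space_def by (rule space_counting_space)

lemma tessellationD:
  assumes "tessellation T"
  shows "z \<in> T \<Longrightarrow> is_cell z" "\<exists>z\<in>T. x \<in> z"
    "z \<in> T \<Longrightarrow> w \<in> T \<Longrightarrow> x \<in> interior z \<Longrightarrow> x \<in> interior w \<Longrightarrow> z = w"
    "compact K \<Longrightarrow> finite {z \<in> T. z \<inter> K \<noteq> {}}"
proof -
  have *: "\<forall>z\<in>T. is_cell z" "\<Union>T = UNIV" "pairwise (\<lambda>z w. interior z \<inter> interior w = {}) T"
    "\<forall>K. compact K \<longrightarrow> finite {z\<in>T. z \<inter> K \<noteq> {}}"
    using assms by (auto simp: tessellation_def)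
  show "z \<in> T \<Longrightarrow> is_cell z" using *(1) by blast
  show "\<exists>z\<in>T. x \<in> z" using *(2) by blast
  show "z \<in> T \<Longrightarrow> w \<in> T \<Longrightarrow> x \<in> interior z \<Longrightarrow> x \<in> interior w \<Longrightarrow> z = w"
    using pairwiseD[OF *(3), of z w] by blast
  show "compact K \<Longrightarrow> finite {z \<in> T. z \<inter> K \<noteq> {}}" using *(4) by blast
qed

text \<open>Induction on \<open>f\<close>: for indicators the sum is a counting function, and
  monotone limits and linear combinations carry over.\<close>

lemma measurable_cell_sum:
  assumes "f \<in> borel_measurable cell_space"
  shows "(\<lambda>T. \<integral>\<^sup>+z. f z \<partial>count_space T) \<in> borel_measurable (tess_space :: 'a::euclidean_space set set measure)"
  using assms
proof (induction f rule: borel_measurable_induct)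
  case (cong f g)
  \<comment> \<open>\<open>f\<close> and \<open>g\<close> agree on cells only, which is enough since
    a tessellation consists of cells.\<close>
  have "(\<integral>\<^sup>+z. f z \<partial>count_space T) = (\<integral>\<^sup>+z. g z \<partial>count_space T)" if "T \<in> space tess_space" for T :: "'a set set"
    using cong that by (intro nn_integral_cong) (auto dest: tessellationD)
  then show ?case
    using cong(4) by (subst measurable_cong[where g = "\<lambda>T. \<integral>\<^sup>+z. g z \<partial>count_space T"])
next
  case (set A)
  have "(\<integral>\<^sup>+z. indicator A z \<partial>count_space T) = emeasure (count_space UNIV) (T \<inter> A)" for T
    by (subst nn_integral_count_space_indicator) 
       (auto simp flip: indicator_inter_arith simp: mult.commute Int_commute)
  then show ?case
    using measurable_emeasure_count_Int[OF set] by (simp add: tess_space_def)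
next
  case (mult u c)
  then show ?case by (simp add: nn_integral_cmult)
next
  case (add u v)
  then show ?case by (simp add: nn_integral_add)
next
  case (seq U)
  have "(\<integral>\<^sup>+z. (SUP i. U i z) \<partial>count_space T) = (SUP i. \<integral>\<^sup>+z. U i z \<partial>count_space T)" for T
    by (rule nn_integral_monotone_convergence_SUP) (use seq in auto)
  then show ?case using seq by (simp add: SUP_apply image_image)
qed

text \<open>The complement is the event that the count in \<open>A\<close> is finite and
  zero.\<close>

lemma sets_tess_space_Bex:
  assumes "A \<in> sets cell_space"
  shows "{T \<in> space tess_space. \<exists>z\<in>T. z \<in> A} \<in> sets tess_space"
proof -
  have "{T \<in> space tess_space. \<exists>z\<in>T. z \<in> A} =
      space tess_space - {T. tessellation T \<and> finite (T \<inter> A) \<and> card (T \<inter> A) = 0}"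
    by (auto simp: card_eq_0_iff) (metis disjoint_iff finite.emptyI)+
  also have "\<dots> \<in> sets tess_space"
    using sets_counting_space_card[OF assms, of "{T. tessellation T}" 0]
    by (intro sets.compl_sets) (simp add: tess_space_def)
  finally show ?thesis .
qed

section \<open>Translations of tessellations and stationarity\<close>

lemma tessellation_translate:
  assumes T: "tessellation T" shows "tessellation (translate v ` T)"
  unfolding tessellation_def
proof (intro conjI allI impI)
  show "\<forall>z\<in>translate v ` T. is_cell z"
    using tessellationD(1)[OF T] is_cell_translate by blast
  have "\<exists>z\<in>translate v ` T. x \<in> z" for x
    using tessellationD(2)[OF T, of "x - v"] by (auto simp: mem_translate)
  then show "\<Union> (translate v ` T) = UNIV" by blast
  show "pairwise (\<lambda>z w. interior z \<inter> interior w = {}) (translate v ` T)"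
    using tessellationD(3)[OF T]
    by (auto simp: pairwise_def interior_translate mem_translate disjoint_iff)
  fix K :: "'a set" assume "compact K"
  have "{z \<in> translate v ` T. z \<inter> K \<noteq> {}} = translate v ` {z \<in> T. z \<inter> translate (- v) K \<noteq> {}}"
    unfolding translate_Int_empty_iff[symmetric] by blast
  then show "finite {z \<in> translate v ` T. z \<inter> K \<noteq> {}}"
    using tessellationD(4)[OF T compact_translate[OF \<open>compact K\<close>, of "- v"]] by simp
qed

text \<open>Translation is injective on cells, so counting translated cells in \<open>A\<close> is
  counting the original cells in the preimage of \<open>A\<close>, which is again
  measurable.\<close>

lemma measurable_translate_tessellation:
  "(\<lambda>T. translate v ` T) \<in> measurable tess_space (tess_space :: 'a::euclidean_space set set measure)"
proof -
  have "(\<lambda>T. translate v ` T) -` {T. tessellation T \<and> finite (T \<inter> A) \<and> card (T \<inter> A) = n}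
      \<inter> space tess_space \<in> sets tess_space" if A: "A \<in> sets cell_space" for A :: "'a set set" and n
  proof -
    define B where "B = translate v -` A \<inter> space cell_space"
    have B: "B \<in> sets cell_space"
      unfolding B_def using A measurable_translate_cell by (rule measurable_sets[rotated])
    have "translate v ` T \<inter> A = translate v ` (T \<inter> B)" if "tessellation T" for T
      using tessellationD(1)[OF that] by (auto simp: B_def)
    moreover have "finite (translate v ` S) \<longleftrightarrow> finite S" "card (translate v ` S) = card S"
      for S :: "'a set set"
      using inj_on_subset[OF inj_translate, of S v] by (auto simp: finite_image_iff card_image)
    ultimately have "(\<lambda>T. translate v ` T) -` {T. tessellation T \<and> finite (T \<inter> A) \<and> card (T \<inter> A) = n}
      \<inter> space tess_space = {T. tessellation T \<and> finite (T \<inter> B) \<and> card (T \<inter> B) = n}"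
      using tessellation_translate by auto
    then show ?thesis
      using sets_counting_space_card[OF B, of "{T. tessellation T}" n] by (simp add: tess_space_def)
  qed
  then have "(\<lambda>T. translate v ` T) \<in> measurable tess_space (sigma {T. tessellation T}
     {{T\<in>{T. tessellation T}. finite (T \<inter> A) \<and> card (T \<inter> A) = n} | (A :: 'a set set) n. A \<in> sets cell_space})"
    by (intro measurable_measure_of) (auto intro!: tessellation_translate)
  then show ?thesis
    unfolding tess_space_def[where 'a='a] counting_space_def .
qed

lemma cell_sum_translate:
  "(\<integral>\<^sup>+z. f z \<partial>count_space (translate v ` T)) = (\<integral>\<^sup>+z. f (translate v z) \<partial>count_space T)"
  by (intro nn_integral_bij_count_space[symmetric] bij_betw_imageI inj_on_subset[OF inj_translate]) auto

text \<open>The cell sum is a measurable functional of the tessellation, so its mean depends only on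
  the law; the shift of the tessellation is then moved into \<open>f\<close>.\<close>

lemma stationary_cell_sum_translate:
  assumes Y: "stationary_random_tessellation M Y" and f: "f \<in> borel_measurable cell_space"
  shows "(\<integral>\<^sup>+\<omega>. (\<integral>\<^sup>+z. f (translate v z) \<partial>count_space (Y \<omega>)) \<partial>M) = (\<integral>\<^sup>+\<omega>. (\<integral>\<^sup>+z. f z \<partial>count_space (Y \<omega>)) \<partial>M)"
proof -
  have Ym: "Y \<in> measurable M tess_space"
    and eq: "distr M tess_space (\<lambda>\<omega>. translate v ` Y \<omega>) = distr M tess_space Y"
    using Y by (auto simp: stationary_random_tessellation_def)
  have "(\<integral>\<^sup>+T. (\<integral>\<^sup>+z. f z \<partial>count_space T) \<partial>distr M tess_space (\<lambda>\<omega>. translate v ` Y \<omega>))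
      = (\<integral>\<^sup>+T. (\<integral>\<^sup>+z. f z \<partial>count_space T) \<partial>distr M tess_space Y)"
    by (simp only: eq)
  then show ?thesis
    using measurable_cell_sum[OF f] Ym measurable_compose[OF Ym measurable_translate_tessellation]
    by (simp add: nn_integral_distr cell_sum_translate)
qed

section \<open>The integer lattice and the half-open unit cubes\<close>

definition int_lattice :: "'a::euclidean_space set" where
  "int_lattice = {k. \<forall>i\<in>Basis. k \<bullet> i \<in> \<int>}"

lemma countable_int_lattice: "countable (int_lattice :: 'a::euclidean_space set)"
proof -
  have "k \<in> (\<lambda>g. \<Sum>i\<in>Basis. of_int (g i) *\<^sub>R i) ` (Pi\<^sub>E Basis (\<lambda>_. UNIV :: int set))"
    if "k \<in> int_lattice" for k :: 'a
  proof
    have "\<And>i. i \<in> Basis \<Longrightarrow> of_int \<lfloor>k \<bullet> i\<rfloor> = k \<bullet> i"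
      using that by (auto simp: int_lattice_def elim!: Ints_cases)
    then have "(\<Sum>i\<in>Basis. of_int (restrict (\<lambda>i. \<lfloor>k \<bullet> i\<rfloor>) Basis i) *\<^sub>R i) = (\<Sum>i\<in>Basis. (k \<bullet> i) *\<^sub>R i)"
      by (intro sum.cong) auto
    then show "k = (\<Sum>i\<in>Basis. of_int (restrict (\<lambda>i. \<lfloor>k \<bullet> i\<rfloor>) Basis i) *\<^sub>R i)"
      by (simp add: euclidean_representation)
  qed auto
  moreover have "countable (Pi\<^sub>E (Basis :: 'a set) (\<lambda>_. UNIV :: int set))"
    by (intro countable_PiE) auto
  ultimately show ?thesis
    by (meson countable_image countable_subset subsetI)
qed

text \<open>The lattice point is the coordinatewise floor of \<open>x\<close>; uniqueness comes from
  the cube being half-open.\<close>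

lemma unit_cube_cover:
  fixes x :: "'a::euclidean_space"
  shows "\<exists>!k. k \<in> int_lattice \<and> x \<in> translate k unit_cube"
proof -
  define k where "k = (\<Sum>i\<in>Basis. of_int \<lfloor>x \<bullet> i\<rfloor> *\<^sub>R i :: 'a)"
  have k: "k \<bullet> i = of_int \<lfloor>x \<bullet> i\<rfloor>" if "i \<in> Basis" for i
    using that by (simp add: k_def inner_sum_left inner_Basis if_distrib cong: if_cong)
  show ?thesis
  proof (intro ex1I[of _ k] conjI)
    show "k \<in> int_lattice" by (simp add: int_lattice_def k)
    show "x \<in> translate k unit_cube"
      by (auto simp: mem_translate unit_cube_def inner_diff_left k) linarith+
  next
    fix j assume j: "j \<in> int_lattice \<and> x \<in> translate j unit_cube"
    show "j = k"
    proof (rule euclidean_eqI)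
      fix i :: 'a assume i: "i \<in> Basis"
      with j obtain m where m: "j \<bullet> i = of_int m" by (auto simp: int_lattice_def elim!: Ints_cases)
      have "0 \<le> x \<bullet> i - j \<bullet> i" "x \<bullet> i - j \<bullet> i < 1"
        using j i by (auto simp: mem_translate unit_cube_def inner_diff_left)
      then have "\<lfloor>x \<bullet> i\<rfloor> = m" using m by linarith
      then show "j \<bullet> i = k \<bullet> i" using m k[OF i] by simp
    qed
  qed
qed

lemma sets_unit_cube [measurable]: "unit_cube \<in> sets (borel :: 'a::euclidean_space measure)"
  unfolding unit_cube_def by measurable

lemma sets_translate_unit_cube [measurable]:
  "translate v unit_cube \<in> sets (borel :: 'a::euclidean_space measure)"
  by (intro sets_borel_translate sets_unit_cube)

text \<open>The half-open cube lies between the open and the closed box, both of volume 1.\<close>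

lemma emeasure_unit_cube: "emeasure lborel (unit_cube :: 'a::euclidean_space set) = 1"
proof (rule antisym)
  have "emeasure lborel (unit_cube :: 'a set) \<le> emeasure lborel (cbox 0 One :: 'a set)"
    by (intro emeasure_mono) (auto simp: unit_cube_def mem_box less_imp_le)
  then show "emeasure lborel (unit_cube :: 'a set) \<le> 1"
    by (simp add: emeasure_lborel_cbox_eq)
  have "emeasure lborel (box 0 One :: 'a set) \<le> emeasure lborel (unit_cube :: 'a set)"
    by (intro emeasure_mono) (auto simp: unit_cube_def mem_box less_imp_le)
  then show "1 \<le> emeasure lborel (unit_cube :: 'a set)"
    by (simp add: emeasure_lborel_box_eq)
qed

lemma lattice_sum_indicator_unit_cube:
  fixes x :: "'a::euclidean_space"
  shows "(\<integral>\<^sup>+k. indicator (translate k unit_cube) x \<partial>count_space int_lattice) = (1 :: ennreal)"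
proof -
  define k where "k = (THE k. k \<in> int_lattice \<and> x \<in> translate k unit_cube)"
  have k: "k \<in> int_lattice" "x \<in> translate k unit_cube"
    using theI'[OF unit_cube_cover[of x]] by (simp_all add: k_def)
  have uniq: "j = k" if "j \<in> int_lattice" "x \<in> translate j unit_cube" for j
    using the1_equality[OF unit_cube_cover[of x], of j] that by (simp add: k_def)
  have "x \<in> translate j unit_cube \<longleftrightarrow> j \<in> {k}" if "j \<in> int_lattice" for j
    using k uniq[OF that] by blast
  then have "indicator (translate j unit_cube) x = (indicator {k} j :: ennreal)" if "j \<in> int_lattice" for j
    using that by (simp only: indicator_def)
  then have "(\<integral>\<^sup>+j. indicator (translate j unit_cube) x \<partial>count_space int_lattice) =
     (\<integral>\<^sup>+j. indicator {k} j \<partial>(count_space int_lattice :: 'a measure))"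
    by (intro nn_integral_cong) simp
  also have "\<dots> = 1" using k by simp
  finally show ?thesis .
qed

text \<open>Read \<open>G k z\<close> as the mass that \<open>z\<close> sends to the cube at
  \<open>k\<close>. The left side is the mean mass sent by the cells with centroid in the unit cube,
  the right side the mean mass received by that cube. Stationarity shifts the \<open>k\<close>-th
  term by \<open>k\<close>, so that the receiver becomes the cube at 0 and the sender sits in the
  cube at \<open>- k\<close>.\<close>

lemma stationary_mass_transport:
  fixes Y :: "'w \<Rightarrow> 'a::euclidean_space set set" and G :: "'a \<Rightarrow> 'a set \<Rightarrow> ennreal"
  assumes Y: "stationary_random_tessellation M Y"
    and G: "\<And>k. G k \<in> borel_measurable cell_space"
    and G_tr: "\<And>k z. is_cell z \<Longrightarrow> G k (translate k z) = G 0 z"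
  shows "(\<integral>\<^sup>+\<omega>. (\<integral>\<^sup>+z. indicator unit_cube (centroid z) * (\<integral>\<^sup>+k. G k z \<partial>count_space int_lattice) \<partial>count_space (Y \<omega>)) \<partial>M)
     = (\<integral>\<^sup>+\<omega>. (\<integral>\<^sup>+z. G 0 z \<partial>count_space (Y \<omega>)) \<partial>M)"
proof -
  let ?F = "\<lambda>k z :: 'a set. indicator (translate k unit_cube) (centroid z) :: ennreal"
  have Ym: "Y \<in> measurable M tess_space"
    using Y by (auto simp: stationary_random_tessellation_def)
  have cell: "is_cell z" if "\<omega> \<in> space M" "z \<in> Y \<omega>" for \<omega> z
    using measurable_space[OF Ym that(1)] that(2) by (auto dest: tessellationD)
  note measurable_centroid [measurable] G [measurable]
  have F: "?F k \<in> borel_measurable cell_space" for k by measurable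
  \<comment> \<open>The lattice is countable, so its sum can be exchanged first with the sum over
    the cells and then with the mean.\<close>
  have swap: "(\<integral>\<^sup>+\<omega>. (\<integral>\<^sup>+z. (\<integral>\<^sup>+k. H k z \<partial>count_space int_lattice) \<partial>count_space (Y \<omega>)) \<partial>M) =
     (\<integral>\<^sup>+k. (\<integral>\<^sup>+\<omega>. (\<integral>\<^sup>+z. H k z \<partial>count_space (Y \<omega>)) \<partial>M) \<partial>count_space int_lattice)"
    if H: "\<And>k. H k \<in> borel_measurable cell_space" for H :: "'a \<Rightarrow> 'a set \<Rightarrow> ennreal"
    by (subst nn_integral_count_space_nn_integral[OF countable_int_lattice], simp)
       (intro nn_integral_count_space_nn_integral[OF countable_int_lattice]
          measurable_compose[OF Ym measurable_cell_sum[OF H]])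
  have "(\<integral>\<^sup>+\<omega>. (\<integral>\<^sup>+z. indicator unit_cube (centroid z) * (\<integral>\<^sup>+k. G k z \<partial>count_space int_lattice) \<partial>count_space (Y \<omega>)) \<partial>M)
     = (\<integral>\<^sup>+\<omega>. (\<integral>\<^sup>+z. (\<integral>\<^sup>+k. ?F 0 z * G k z \<partial>count_space int_lattice) \<partial>count_space (Y \<omega>)) \<partial>M)"
    by (simp add: nn_integral_cmult)
  also have "\<dots> = (\<integral>\<^sup>+k. (\<integral>\<^sup>+\<omega>. (\<integral>\<^sup>+z. ?F 0 z * G k z \<partial>count_space (Y \<omega>)) \<partial>M) \<partial>count_space int_lattice)"
    by (rule swap) measurable
  also have "\<dots> = (\<integral>\<^sup>+k. (\<integral>\<^sup>+\<omega>. (\<integral>\<^sup>+z. ?F (- k) z * G 0 z \<partial>count_space (Y \<omega>)) \<partial>M) \<partial>count_space int_lattice)"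
  proof (rule nn_integral_cong)
    \<comment> \<open>The only use of stationarity: under the shift by \<open>k\<close>, the
      centroid condition moves to the cube at \<open>- k\<close> and \<open>G k\<close> turns into
      \<open>G 0\<close>.\<close>
    fix k
    have "(\<integral>\<^sup>+\<omega>. (\<integral>\<^sup>+z. ?F 0 z * G k z \<partial>count_space (Y \<omega>)) \<partial>M) =
      (\<integral>\<^sup>+\<omega>. (\<integral>\<^sup>+z. ?F 0 (translate k z) * G k (translate k z) \<partial>count_space (Y \<omega>)) \<partial>M)"
      by (rule stationary_cell_sum_translate[OF Y, symmetric]) measurable
    also have "\<dots> = (\<integral>\<^sup>+\<omega>. (\<integral>\<^sup>+z. ?F (- k) z * G 0 z \<partial>count_space (Y \<omega>)) \<partial>M)"
      by (intro nn_integral_cong)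
         (auto simp: cell G_tr centroid_translate mem_translate indicator_def algebra_simps)
    finally show "(\<integral>\<^sup>+\<omega>. (\<integral>\<^sup>+z. ?F 0 z * G k z \<partial>count_space (Y \<omega>)) \<partial>M) =
      (\<integral>\<^sup>+\<omega>. (\<integral>\<^sup>+z. ?F (- k) z * G 0 z \<partial>count_space (Y \<omega>)) \<partial>M)" .
  qed
  also have "\<dots> = (\<integral>\<^sup>+\<omega>. (\<integral>\<^sup>+z. (\<integral>\<^sup>+k. ?F (- k) z * G 0 z \<partial>count_space int_lattice) \<partial>count_space (Y \<omega>)) \<partial>M)"
    by (rule swap[symmetric]) measurable
  also have "\<dots> = (\<integral>\<^sup>+\<omega>. (\<integral>\<^sup>+z. G 0 z \<partial>count_space (Y \<omega>)) \<partial>M)"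
  proof (intro nn_integral_cong)
    fix \<omega> z
    \<comment> \<open>Reflection permutes the lattice, and each centroid lies in exactly one cube,
      so the weights add up to 1.\<close>
    have "bij_betw uminus int_lattice (int_lattice :: 'a set)"
      by (rule bij_betw_byWitness[of _ uminus]) (auto simp: int_lattice_def)
    then have "(\<integral>\<^sup>+k. ?F (- k) z \<partial>count_space int_lattice) = (\<integral>\<^sup>+k. ?F k z \<partial>count_space int_lattice)"
      by (rule nn_integral_bij_count_space)
    then show "(\<integral>\<^sup>+k. ?F (- k) z * G 0 z \<partial>count_space int_lattice) = G 0 z"
      by (simp add: nn_integral_multc lattice_sum_indicator_unit_cube)
  qed
  finally show ?thesis .
qed

section \<open>Volumes of cells and the intensity seen from other reference points\<close>

lemma countable_tessellation:
  assumes T: "tessellation (T :: 'a::euclidean_space set set)" shows "countable T"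
proof -
  \<comment> \<open>Each cell meets some ball of integer radius, and each such ball meets only
    finitely many cells.\<close>
  have "T \<subseteq> (\<Union>n::nat. {z \<in> T. z \<inter> cball 0 (real n) \<noteq> {}})"
  proof
    fix z assume z: "z \<in> T"
    then obtain x where x: "x \<in> z" using is_cellD(7) tessellationD(1)[OF T] by blast
    obtain n :: nat where "norm x \<le> n" using real_arch_simple by blast
    with x have "x \<in> z \<inter> cball 0 (real n)" by simp
    with z show "z \<in> (\<Union>n::nat. {z \<in> T. z \<inter> cball 0 (real n) \<noteq> {}})" by blast
  qed
  moreover have "countable (\<Union>n::nat. {z \<in> T. z \<inter> cball 0 (real n) \<noteq> {}})"
    using tessellationD(4)[OF T compact_cball] by (intro countable_UN) (auto intro: countable_finite)
  ultimately show ?thesis by (rule countable_subset)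
qed

lemma frontier_cell_null: "is_cell z \<Longrightarrow> frontier z \<in> null_sets lborel"
  using negligible_convex_frontier[OF is_cellD(5), of z]
  by (simp add: negligible_iff_null_sets null_sets_completion_iff borel_closed)

text \<open>The frontiers of the countably many cells form a null set \<open>N\<close>. Replacing
  cells by their interiors changes no volume, makes them disjoint and still covers everything
  outside \<open>N\<close>.\<close>

lemma sum_volume_Int:
  assumes T: "tessellation T" and C: "C \<in> sets borel"
  shows "(\<integral>\<^sup>+z. emeasure lborel (z \<inter> C) \<partial>count_space T) = emeasure lborel C"
proof -
  define N where "N = (\<Union>z\<in>T. frontier z)"
  have N: "N \<in> null_sets lborel"
    unfolding N_def
    by (intro null_sets_UN' countable_tessellation[OF T] frontier_cell_null tessellationD(1)[OF T])
  have I: "interior z \<inter> C \<in> sets lborel" for z using C by (simp add: borel_open)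
  have "emeasure lborel (z \<inter> C) = emeasure lborel (interior z \<inter> C)" if "z \<in> T" for z
  proof (rule emeasure_eq_AE)
    have z: "is_cell z" using tessellationD(1)[OF T that] .
    show "AE x in lborel. (x \<in> z \<inter> C) = (x \<in> interior z \<inter> C)"
      using frontier_cell_null[OF z, THEN AE_not_in]
      by eventually_elim (use is_cellD(4)[OF z] interior_subset in \<open>auto simp: frontier_def\<close>)
    show "z \<inter> C \<in> sets lborel" using is_cellD(8)[OF z] C by simp
  qed (rule I)
  then have "(\<integral>\<^sup>+z. emeasure lborel (z \<inter> C) \<partial>count_space T) =
      (\<integral>\<^sup>+z. emeasure lborel (interior z \<inter> C) \<partial>count_space T)"
    by (intro nn_integral_cong) simp
  also have "\<dots> = emeasure lborel (\<Union>z\<in>T. interior z \<inter> C)"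
    by (rule emeasure_UN_countable[symmetric])
       (use I countable_tessellation[OF T] tessellationD(3)[OF T] in \<open>auto simp: disjoint_family_on_def\<close>)
  also have "\<dots> = emeasure lborel C"
  proof (rule emeasure_eq_AE)
    show "AE x in lborel. (x \<in> (\<Union>z\<in>T. interior z \<inter> C)) = (x \<in> C)"
      using N[THEN AE_not_in]
    proof eventually_elim
      fix x assume x: "x \<notin> N"
      obtain z where z: "z \<in> T" "x \<in> z" using tessellationD(2)[OF T] by blast
      with x have "x \<in> interior z"
        using is_cellD(4)[OF tessellationD(1)[OF T z(1)]] by (auto simp: N_def frontier_def)
      with z show "(x \<in> (\<Union>z\<in>T. interior z \<inter> C)) = (x \<in> C)" by blast
    qed
    show "(\<Union>z\<in>T. interior z \<inter> C) \<in> sets lborel"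
      by (intro sets.countable_UN' countable_tessellation[OF T]) (use I in auto)
  qed (use C in simp)
  finally show ?thesis .
qed

lemma nn_integral_count_space_Collect:
  "(\<integral>\<^sup>+z. f z \<partial>count_space {z \<in> T. g z \<in> A}) = (\<integral>\<^sup>+z. indicator A (g z) * f z \<partial>count_space T)"
proof -
  have "(\<integral>\<^sup>+z. f z \<partial>count_space {z \<in> T. g z \<in> A}) = (\<integral>\<^sup>+z. f z * indicator {z \<in> T. g z \<in> A} z \<partial>count_space UNIV)"
    by (simp add: nn_integral_count_space_indicator)
  also have "\<dots> = (\<integral>\<^sup>+z. indicator A (g z) * f z * indicator T z \<partial>count_space UNIV)"
    by (intro nn_integral_cong) (auto simp: indicator_def)
  finally show ?thesis
    by (simp add: nn_integral_count_space_indicator)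
qed

lemma emeasure_count_space_Collect:
  "emeasure (count_space UNIV) {z \<in> T. g z \<in> A} = (\<integral>\<^sup>+z. indicator A (g z) \<partial>count_space T)"
proof -
  have "emeasure (count_space UNIV) {z \<in> T. g z \<in> A} = (\<integral>\<^sup>+z. 1 \<partial>count_space {z \<in> T. g z \<in> A})"
    by (simp add: emeasure_count_space)
  also have "\<dots> = (\<integral>\<^sup>+z. indicator A (g z) \<partial>count_space T)"
    unfolding nn_integral_count_space_Collect by simp
  finally show ?thesis .
qed

text \<open>Mass transport with \<open>G k z\<close> the volume of \<open>z\<close> inside the cube
  at \<open>k\<close>: a cell sends its whole volume, and the unit cube receives its own volume,
  since the cells fill it.\<close>

lemma stationary_volume_sum:
  assumes Y: "stationary_random_tessellation M Y"
  shows "(\<integral>\<^sup>+\<omega>. (\<integral>\<^sup>+z. emeasure lborel z \<partial>count_space {z \<in> Y \<omega>. centroid z \<in> unit_cube}) \<partial>M) = 1"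
proof -
  have "prob_space M" and Ym: "Y \<in> measurable M tess_space"
    using Y by (auto simp: stationary_random_tessellation_def)
  then interpret prob_space M by simp
  have tess: "tessellation (Y \<omega>)" if "\<omega> \<in> space M" for \<omega>
    using measurable_space[OF Ym that] by simp
  have vol: "emeasure lborel z = (\<integral>\<^sup>+k. emeasure lborel (z \<inter> translate k unit_cube) \<partial>count_space int_lattice)"
    if z: "is_cell z" for z :: "'b set"
  proof -
    have "emeasure lborel z = emeasure lborel (\<Union>k\<in>int_lattice. z \<inter> translate k unit_cube)"
      using unit_cube_cover by (intro arg_cong[where f = "emeasure lborel"]) blast
    also have "\<dots> = (\<integral>\<^sup>+k. emeasure lborel (z \<inter> translate k unit_cube) \<partial>count_space int_lattice)"
      using is_cellD(8)[OF z] unit_cube_cover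
      by (intro emeasure_UN_countable countable_int_lattice)
         (auto simp: disjoint_family_on_def)
    finally show ?thesis .
  qed
  have "(\<integral>\<^sup>+\<omega>. (\<integral>\<^sup>+z. emeasure lborel z \<partial>count_space {z \<in> Y \<omega>. centroid z \<in> unit_cube}) \<partial>M) =
    (\<integral>\<^sup>+\<omega>. (\<integral>\<^sup>+z. indicator unit_cube (centroid z) *
        (\<integral>\<^sup>+k. emeasure lborel (z \<inter> translate k unit_cube) \<partial>count_space int_lattice) \<partial>count_space (Y \<omega>)) \<partial>M)"
    unfolding nn_integral_count_space_Collect
    by (intro nn_integral_cong arg_cong2[where f = "(*)"] vol) (auto dest: tess tessellationD(1))
  also have "\<dots> = (\<integral>\<^sup>+\<omega>. (\<integral>\<^sup>+z. emeasure lborel (z \<inter> translate 0 unit_cube) \<partial>count_space (Y \<omega>)) \<partial>M)"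
    by (rule stationary_mass_transport[OF Y measurable_emeasure_cell_Int])
       (simp_all add: emeasure_lborel_translate sets.Int is_cellD(8) flip: translate_Int)
  also have "\<dots> = (\<integral>\<^sup>+\<omega>. 1 \<partial>M)"
    by (intro nn_integral_cong) (simp add: sum_volume_Int tess emeasure_unit_cube)
  finally show ?thesis by (simp add: emeasure_space_1)
qed

text \<open>Each cell sends unit mass from the cube of its centroid to the cube of
  \<open>p z\<close>. So the intensity may be counted with any equivariant reference point.\<close>

lemma cell_intensity_eq_reference_point:
  fixes Y :: "'w \<Rightarrow> 'a::euclidean_space set set"
  assumes Y: "stationary_random_tessellation M Y"
    and p [measurable]: "p \<in> borel_measurable cell_space"
    and p_tr: "\<And>v z. is_cell z \<Longrightarrow> p (translate v z) = v + p z"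
  shows "cell_intensity M Y = (\<integral>\<^sup>+\<omega>. (\<integral>\<^sup>+z. indicator unit_cube (p z) \<partial>count_space (Y \<omega>)) \<partial>M)"
proof -
  have "cell_intensity M Y = (\<integral>\<^sup>+\<omega>. (\<integral>\<^sup>+z. indicator unit_cube (centroid z) *
     (\<integral>\<^sup>+k. indicator (translate k unit_cube) (p z) \<partial>count_space int_lattice) \<partial>count_space (Y \<omega>)) \<partial>M)"
    unfolding cell_intensity_def emeasure_count_space_Collect
    by (simp add: lattice_sum_indicator_unit_cube)
  also have "\<dots> = (\<integral>\<^sup>+\<omega>. (\<integral>\<^sup>+z. indicator (translate 0 unit_cube) (p z) \<partial>count_space (Y \<omega>)) \<partial>M)"
    by (rule stationary_mass_transport[OF Y]) (measurable, simp add: p_tr mem_translate indicator_def)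
  finally show ?thesis by simp
qed

subsection \<open>Measurable selection of cells\<close>

text \<open>The description is determinate only for \<open>x\<close> in the interior of a cell;
  frontier points are kept away by the choice of index below.\<close>

definition cell_at :: "'a::euclidean_space set set \<Rightarrow> 'a \<Rightarrow> 'a set" where
  "cell_at T x = (THE z. z \<in> T \<and> x \<in> interior z)"

lemma cell_at_eq: "tessellation T \<Longrightarrow> z \<in> T \<Longrightarrow> x \<in> interior z \<Longrightarrow> cell_at T x = z"
  unfolding cell_at_def by (rule the_equality) (blast dest: tessellationD(3))+

text \<open>If no cell of \<open>T\<close> has \<open>q n\<close> in its interior, the selected cell is the first one hit by \<open>q\<close>.\<close>

definition select_index :: "(nat \<Rightarrow> 'a::euclidean_space) \<Rightarrow> nat \<Rightarrow> 'a set set \<Rightarrow> nat" where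
  "select_index q n T = (if \<exists>z\<in>T. q n \<in> interior z then n else LEAST m. \<exists>z\<in>T. q m \<in> interior z)"

definition select_cell :: "(nat \<Rightarrow> 'a::euclidean_space) \<Rightarrow> nat \<Rightarrow> 'a set set \<Rightarrow> 'a set" where
  "select_cell q n T = cell_at T (q (select_index q n T))"

text \<open>Keeps one index per cell: the first conjunct discards the fallback selections, the
  second one discards later hits of the same cell.\<close>

definition first_hit :: "(nat \<Rightarrow> 'a::euclidean_space) \<Rightarrow> nat \<Rightarrow> 'a set set \<Rightarrow> bool" where
  "first_hit q n T \<longleftrightarrow> (\<exists>z\<in>T. q n \<in> interior z) \<and> (\<forall>m<n. q m \<notin> interior (select_cell q n T))"

lemma select_cell_eq:
  "tessellation T \<Longrightarrow> z \<in> T \<Longrightarrow> q n \<in> interior z \<Longrightarrow> select_cell q n T = z"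
  unfolding select_cell_def select_index_def using cell_at_eq by auto

context
  fixes q :: "nat \<Rightarrow> 'a::euclidean_space"
  assumes q: "\<And>U. open U \<Longrightarrow> U \<noteq> {} \<Longrightarrow> \<exists>n. q n \<in> U"
begin

text \<open>Cells have nonempty interior, so the dense sequence hits one and the
  \<open>LEAST\<close> in the fallback exists.\<close>

lemma select_index_hit:
  assumes T: "tessellation T"
  shows "\<exists>z\<in>T. q (select_index q n T) \<in> interior z"
proof (cases "\<exists>z\<in>T. q n \<in> interior z")
  case False
  obtain z where z: "z \<in> T" using tessellationD(2)[OF T] by blast
  then obtain m where "q m \<in> interior z"
    using q[of "interior z"] is_cellD(2)[OF tessellationD(1)[OF T]] by auto
  with z have "\<exists>m. \<exists>z\<in>T. q m \<in> interior z" by blast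
  from LeastI_ex[OF this] show ?thesis using False by (simp add: select_index_def)
qed (simp add: select_index_def)

lemma pred_hit: "Measurable.pred tess_space (\<lambda>T. \<exists>z\<in>T. x \<in> interior z)"
proof -
  have "{T \<in> space tess_space. \<exists>z\<in>T. x \<in> interior z} =
      {T \<in> space tess_space. \<exists>z\<in>T. z \<in> {z \<in> space cell_space. x \<in> interior z}}"
    by (auto dest: tessellationD(1))
  also have "\<dots> \<in> sets tess_space"
    by (intro sets_tess_space_Bex predE pred_mem_interior_cell)
  finally show ?thesis by (simp add: Measurable.pred_def)
qed

text \<open>Split by the value \<open>m\<close> of the index. As at most one cell has
  \<open>q m\<close> in its interior, the selected cell lies in \<open>B\<close> iff some cell of
  \<open>T\<close> with \<open>q m\<close> in its interior does, which is an existence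
  event.\<close>

lemma measurable_select_cell: "select_cell q n \<in> measurable tess_space cell_space"
proof (rule measurableI)
  show "select_cell q n T \<in> space cell_space" if "T \<in> space tess_space" for T
    using select_index_hit[of T n] cell_at_eq[of T] that tessellationD(1)[of T]
    by (auto simp: select_cell_def)
  fix B assume B: "B \<in> sets (cell_space :: 'a set measure)"
  have idx: "select_index q n \<in> measurable tess_space (count_space UNIV)"
    unfolding select_index_def using pred_hit
    by (intro measurable_If measurable_Least measurable_const) (auto simp: Measurable.pred_def)
  have "select_cell q n -` B \<inter> space tess_space =
    (\<Union>m. (select_index q n -` {m} \<inter> space tess_space) \<inter>
       {T \<in> space tess_space. \<exists>z\<in>T. z \<in> {z \<in> space cell_space. q m \<in> interior z} \<inter> B})"
  proof (intro set_eqI iffI)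
    fix T assume T: "T \<in> select_cell q n -` B \<inter> space tess_space"
    then have tess: "tessellation T" by simp
    obtain z where z: "z \<in> T" "q (select_index q n T) \<in> interior z"
      using select_index_hit[OF tess] by blast
    then have "z \<in> {z \<in> space cell_space. q (select_index q n T) \<in> interior z} \<inter> B"
      using T cell_at_eq[OF tess z] tessellationD(1)[OF tess] by (auto simp: select_cell_def)
    then show "T \<in> (\<Union>m. (select_index q n -` {m} \<inter> space tess_space) \<inter>
       {T \<in> space tess_space. \<exists>z\<in>T. z \<in> {z \<in> space cell_space. q m \<in> interior z} \<inter> B})"
      using z T by blast
  next
    fix T assume "T \<in> (\<Union>m. (select_index q n -` {m} \<inter> space tess_space) \<inter>
       {T \<in> space tess_space. \<exists>z\<in>T. z \<in> {z \<in> space cell_space. q m \<in> interior z} \<inter> B})"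
    then obtain z where "tessellation T" "z \<in> T" "q (select_index q n T) \<in> interior z" "z \<in> B"
      by auto
    then show "T \<in> select_cell q n -` B \<inter> space tess_space"
      using cell_at_eq[of T z] by (auto simp: select_cell_def)
  qed
  also have "\<dots> \<in> sets tess_space"
    by (intro sets.countable_UN sets.Int measurable_sets[OF idx] sets_tess_space_Bex
        predE pred_mem_interior_cell B image_subsetI) auto
  finally show "select_cell q n -` B \<inter> space tess_space \<in> sets tess_space" .
qed

lemma cell_selector_select_cell: "cell_selector (select_cell q n)"
  unfolding cell_selector_def
proof (intro conjI measurable_select_cell allI impI)
  fix T :: "'a set set" assume T: "tessellation T"
  then show "select_cell q n T \<in> T"
    using select_index_hit[OF T] cell_at_eq[OF T] by (auto simp: select_cell_def)
qed

lemma pred_first_hit: "Measurable.pred tess_space (first_hit q n)"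
  unfolding first_hit_def
  by (intro pred_intros_logic pred_intros_countable pred_hit
      measurable_compose[OF measurable_select_cell pred_mem_interior_cell] measurable_const) auto

text \<open>If two kept indices gave the same cell, the smaller would be an earlier hit of it.
  Conversely, a cell is obtained from the least index hitting its interior.\<close>

lemma bij_betw_select_cell:
  assumes T: "tessellation T"
  shows "bij_betw (\<lambda>n. select_cell q n T) {n. first_hit q n T} T"
proof (rule bij_betw_imageI)
  have hit: "q n \<in> interior (select_cell q n T)" if "first_hit q n T" for n
    using that select_cell_eq[OF T] by (auto simp: first_hit_def)
  show "inj_on (\<lambda>n. select_cell q n T) {n. first_hit q n T}"
  proof (rule inj_onI)
    fix m n assume "m \<in> {n. first_hit q n T}" "n \<in> {n. first_hit q n T}"
      and "select_cell q m T = select_cell q n T"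
    then show "m = n"
      using hit[of m] hit[of n] by (metis first_hit_def linorder_neqE_nat mem_Collect_eq)
  qed
  show "(\<lambda>n. select_cell q n T) ` {n. first_hit q n T} = T"
  proof
    show "(\<lambda>n. select_cell q n T) ` {n. first_hit q n T} \<subseteq> T"
      using cell_selector_select_cell T by (auto simp: cell_selector_def)
    show "T \<subseteq> (\<lambda>n. select_cell q n T) ` {n. first_hit q n T}"
    proof
      fix z assume z: "z \<in> T"
      define n where "n = (LEAST n. q n \<in> interior z)"
      have "\<exists>n. q n \<in> interior z"
        using q[of "interior z"] is_cellD(2)[OF tessellationD(1)[OF T z]] by auto
      then have n: "q n \<in> interior z" unfolding n_def by (rule LeastI_ex)
      have sel: "select_cell q n T = z" by (rule select_cell_eq) (fact T z n)+
      have "q m \<notin> interior z" if "m < n" for m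
        using not_less_Least that unfolding n_def by blast
      then have "first_hit q n T"
        unfolding first_hit_def sel using n z by blast
      with sel show "z \<in> (\<lambda>n. select_cell q n T) ` {n. first_hit q n T}" by blast
    qed
  qed
qed

text \<open>Replaces the random index set of the cells by the fixed index set of naturals, so that
  each term involves one selector and can be conditioned on separately.\<close>

lemma cell_sum_eq_select_sum:
  assumes "tessellation T"
  shows "(\<integral>\<^sup>+z. f z \<partial>count_space T) = 
    (\<integral>\<^sup>+n. (if first_hit q n T then f (select_cell q n T) else 0) \<partial>count_space UNIV)"
proof -
  have "(\<integral>\<^sup>+z. f z \<partial>count_space T) = (\<integral>\<^sup>+n. f (select_cell q n T) \<partial>count_space {n. first_hit q n T})"
    by (rule nn_integral_bij_count_space[OF bij_betw_select_cell[OF assms], symmetric])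
  then show ?thesis
    by (simp add: nn_integral_count_space_indicator indicator_def of_bool_def if_distrib cong: if_cong)
qed

end

subsection \<open>Column tessellations\<close>

lemma stationary_random_tessellation_tessellation:
  assumes "stationary_random_tessellation M Y" and "\<omega> \<in> space M"
  shows "tessellation (Y \<omega>)"
proof -
  have "Y \<in> measurable M tess_space" using assms(1) by (simp add: stationary_random_tessellation_def)
  from measurable_space[OF this assms(2)] show ?thesis by simp
qed

text \<open>In the series over selectors, the weight of the \<open>n\<close>-th term is a function
  of \<open>Y'\<close>. Hence the point count may be replaced by its conditional mean given
  \<open>Y'\<close>, which is the mark of the selected cell.\<close>

lemma line_process_intensity_sum:
  fixes Y' :: "'w \<Rightarrow> 'a::euclidean_space set set"
  assumes Y': "stationary_random_tessellation M Y'" and \<rho>: "cell_mark \<rho>"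
    and \<Phi>: "line_processes M Y' \<rho> \<Phi>" and h: "h \<in> borel_measurable cell_space"
  shows "(\<integral>\<^sup>+\<omega>. (\<integral>\<^sup>+z. h z * emeasure (count_space UNIV) (\<Phi> \<omega> z \<inter> {0..<1}) \<partial>count_space (Y' \<omega>)) \<partial>M)
    = (\<integral>\<^sup>+\<omega>. (\<integral>\<^sup>+z. h z * ennreal (\<rho> (Y' \<omega>) z) \<partial>count_space (Y' \<omega>)) \<partial>M)"
proof -
  obtain q :: "nat \<Rightarrow> 'a" where q: "\<And>U. open U \<Longrightarrow> U \<noteq> {} \<Longrightarrow> \<exists>n. q n \<in> U"
    using dense_sequence by metis
  define s where "s = select_cell q"
  have s: "cell_selector (s n)" and sm: "s n \<in> measurable tess_space cell_space" for n
    unfolding s_def using cell_selector_select_cell[OF q] measurable_select_cell[OF q] by blast+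
  have "prob_space M" and Ym: "Y' \<in> measurable M tess_space"
    using Y' by (auto simp: stationary_random_tessellation_def)
  then interpret prob_space M by simp
  define F where "F = generated_by M Y'"
  have YF: "Y' \<in> measurable F tess_space"
    unfolding F_def generated_by_def
    by (intro measurable_vimage_algebra1) (use measurable_space[OF Ym] in auto)
  have "subalgebra M F"
    unfolding subalgebra_def F_def generated_by_def
    using Ym measurable_space[OF Ym] measurable_sets[OF Ym] by (auto simp: sets_vimage_algebra2)
  \<comment> \<open>Finiteness of \<open>M\<close> gives the \<sigma>-finiteness that the calculus
    of conditional expectations asks for.\<close>
  then have "finite_measure_subalgebra M F"
    by (simp add: finite_measure_subalgebra_def finite_measure_subalgebra_axioms_def finite_measure_axioms)
  then interpret F: sigma_finite_subalgebra M F
    by (rule finite_measure_subalgebra_is_sigma_finite)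
  \<comment> \<open>The weight vanishes unless \<open>n\<close> is the first index of its cell, so
    every cell is counted once.\<close>
  define w where "w n \<omega> = (if first_hit q n (Y' \<omega>) then h (s n (Y' \<omega>)) else 0)" for n \<omega>
  define c where "c n \<omega> = emeasure (count_space UNIV) (\<Phi> \<omega> (s n (Y' \<omega>)) \<inter> {0..<1})" for n \<omega>
  define r where "r n \<omega> = ennreal (\<rho> (Y' \<omega>) (s n (Y' \<omega>)))" for n \<omega>
  have "(\<lambda>T. if first_hit q n T then h (s n T) else 0) \<in> borel_measurable tess_space" for n
    using pred_first_hit[OF q, of n] measurable_compose[OF sm h]
    by (intro measurable_If) (auto simp: Measurable.pred_def)
  then have wF: "w n \<in> borel_measurable F" for n
    unfolding w_def by (rule measurable_compose[OF YF])
  then have wM: "w n \<in> borel_measurable M" for n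
    by (rule measurable_from_subalg[OF F.subalg])
  have cM: "c n \<in> borel_measurable M" for n
  proof -
    have "(\<lambda>\<omega>. \<Phi> \<omega> (s n (Y' \<omega>))) \<in> measurable M config_space"
      using \<Phi> s by (simp add: line_processes_def)
    then show ?thesis
      unfolding c_def config_space_def
      by (rule measurable_compose) (rule measurable_emeasure_count_Int, simp)
  qed
  have rM: "r n \<in> borel_measurable M" for n
  proof -
    have "(\<lambda>T. (T, s n T)) \<in> measurable tess_space (tess_space \<Otimes>\<^sub>M cell_space)"
      using sm by simp
    from measurable_compose[OF this, of "\<lambda>(T, z). \<rho> T z" borel]
    have "(\<lambda>T. \<rho> T (s n T)) \<in> borel_measurable tess_space"
      using \<rho> by (simp add: cell_mark_def)
    from measurable_compose[OF Ym this] show ?thesis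
      unfolding r_def by measurable
  qed
  have "\<forall>g. cell_selector g \<longrightarrow>
        (AE \<omega> in M.
           nn_cond_exp M F
             (\<lambda>\<omega>. emeasure (count_space UNIV) (\<Phi> \<omega> (g (Y' \<omega>)) \<inter> {0..<1})) \<omega> =
           ennreal (\<rho> (Y' \<omega>) (g (Y' \<omega>))))"
    using \<Phi> unfolding line_processes_def F_def by (elim conjE)
  then have ae: "AE \<omega> in M. nn_cond_exp M F (c n) \<omega> = r n \<omega>" for n
    using s unfolding c_def r_def by simp
  have "(\<integral>\<^sup>+\<omega>. w n \<omega> * nn_cond_exp M F (c n) \<omega> \<partial>M) = (\<integral>\<^sup>+\<omega>. w n \<omega> * r n \<omega> \<partial>M)" for n
    using ae[of n] by (intro nn_integral_cong_AE) auto
  \<comment> \<open>The defining property of conditional expectation, applied to the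
    \<open>F\<close>-measurable weight \<open>w n\<close>.\<close>
  then have *: "(\<integral>\<^sup>+\<omega>. w n \<omega> * c n \<omega> \<partial>M) = (\<integral>\<^sup>+\<omega>. w n \<omega> * r n \<omega> \<partial>M)" for n
    unfolding F.nn_cond_exp_intg[OF wF cM] .
  \<comment> \<open>\<open>g\<close> may depend on \<omega>, so that this covers both the point
    counts and the marks.\<close>
  have sum_eq: "(\<integral>\<^sup>+z. h z * g \<omega> z \<partial>count_space (Y' \<omega>)) =
      (\<integral>\<^sup>+n. w n \<omega> * g \<omega> (s n (Y' \<omega>)) \<partial>count_space UNIV)" if "\<omega> \<in> space M" for \<omega> g
    using measurable_space[OF Ym that]
    by (simp add: cell_sum_eq_select_sum[OF q] w_def s_def if_distrib[of "\<lambda>x. x * _"] cong: if_cong)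
  have "(\<integral>\<^sup>+\<omega>. (\<integral>\<^sup>+z. h z * emeasure (count_space UNIV) (\<Phi> \<omega> z \<inter> {0..<1}) \<partial>count_space (Y' \<omega>)) \<partial>M)
     = (\<integral>\<^sup>+\<omega>. (\<integral>\<^sup>+n. w n \<omega> * c n \<omega> \<partial>count_space UNIV) \<partial>M)"
    unfolding c_def by (intro nn_integral_cong sum_eq)
  also have "\<dots> = (\<integral>\<^sup>+n. (\<integral>\<^sup>+\<omega>. w n \<omega> * c n \<omega> \<partial>M) \<partial>count_space UNIV)"
    by (intro nn_integral_count_space_nn_integral) (use wM cM in auto)
  also have "\<dots> = (\<integral>\<^sup>+n. (\<integral>\<^sup>+\<omega>. w n \<omega> * r n \<omega> \<partial>M) \<partial>count_space UNIV)"
    by (simp add: *)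
  also have "\<dots> = (\<integral>\<^sup>+\<omega>. (\<integral>\<^sup>+n. w n \<omega> * r n \<omega> \<partial>count_space UNIV) \<partial>M)"
    by (intro nn_integral_count_space_nn_integral[symmetric]) (use wM rM in auto)
  also have "\<dots> = (\<integral>\<^sup>+\<omega>. (\<integral>\<^sup>+z. h z * ennreal (\<rho> (Y' \<omega>) z) \<partial>count_space (Y' \<omega>)) \<partial>M)"
    unfolding r_def by (intro nn_integral_cong sum_eq[symmetric])
  finally show ?thesis .
qed

text \<open>Every cell is the value of some selector, and a selected configuration lies in
  \<open>config_space\<close> for every \<omega>, not merely almost surely.\<close>

lemma line_processes_locally_finite:
  fixes Y' :: "'w \<Rightarrow> 'a::euclidean_space set set"
  assumes Y': "stationary_random_tessellation M Y'" and \<Phi>: "line_processes M Y' \<rho> \<Phi>"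
    and \<omega>: "\<omega> \<in> space M" and z: "z \<in> Y' \<omega>" and K: "compact K"
  shows "finite (\<Phi> \<omega> z \<inter> K)"
proof -
  obtain q :: "nat \<Rightarrow> 'a" where q: "\<And>U. open U \<Longrightarrow> U \<noteq> {} \<Longrightarrow> \<exists>n. q n \<in> U"
    using dense_sequence by metis
  have T: "tessellation (Y' \<omega>)"
    using Y' \<omega> by (rule stationary_random_tessellation_tessellation)
  obtain n where "q n \<in> interior z"
    using q[of "interior z"] is_cellD(2)[OF tessellationD(1)[OF T z]] by auto
  then have "select_cell q n (Y' \<omega>) = z" using T z by (intro select_cell_eq)
  moreover have "(\<lambda>\<omega>. \<Phi> \<omega> (select_cell q n (Y' \<omega>))) \<in> measurable M config_space"
    using \<Phi> cell_selector_select_cell[OF q] by (simp add: line_processes_def)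
  from measurable_space[OF this \<omega>]
  have "\<forall>K. compact K \<longrightarrow> finite (\<Phi> \<omega> (select_cell q n (Y' \<omega>)) \<inter> K)"
    by (simp add: config_space_def space_counting_space)
  ultimately show ?thesis using K by simp
qed

section \<open>Prisms of a column tessellation and their bottom facets\<close>

lemma fst_centroid_prism:
  fixes z :: "'a::euclidean_space set" and a b :: real
  assumes z: "is_cell z" and ab: "a < b"
  shows "fst (centroid (z \<times> {a..b})) = centroid z"
proof -
  have vol: "measure lborel (z \<times> {a..b}) = measure lborel z * (b - a)"
    using ab is_cellD(8)[OF z]
    by (simp add: measure_def lborel.emeasure_pair_measure_Times enn2real_mult flip: lborel_prod)
  have int: "integrable lborel (\<lambda>x. indicator (z \<times> {a..b}) x *\<^sub>R x)"
    by (intro borel_integrable_compact compact_Times is_cellD(3)[OF z]) (auto intro: continuous_intros)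
  have "fst (LINT x|lborel. indicator (z \<times> {a..b}) x *\<^sub>R x) =
      (LINT x|lborel. fst (indicator (z \<times> {a..b}) x *\<^sub>R x))"
    by (rule integral_fst[OF int, symmetric])
  also have "\<dots> = (LINT x|(lborel \<Otimes>\<^sub>M lborel). fst (indicator (z \<times> {a..b}) x *\<^sub>R x))"
    by (simp only: lborel_prod)
  \<comment> \<open>By Fubini, the horizontal part of the integral is the integral over
    \<open>z\<close> times \<open>b - a\<close>; the same factor in \<open>vol\<close> cancels
    it.\<close>
  also have "\<dots> = (LINT x|lborel. LINT t|lborel. fst (indicator (z \<times> {a..b}) (x, t) *\<^sub>R (x, t)))"
    using integrable_bounded_linear[OF bounded_linear_fst int]
    by (intro lborel_pair.integral_fst'[symmetric]) (simp only: lborel_prod)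
  also have "\<dots> = (LINT x|lborel. LINT t|lborel. indicator {a..b} t *\<^sub>R (indicator z x *\<^sub>R x))"
    by (intro Bochner_Integration.integral_cong) (auto simp: indicator_def)
  also have "\<dots> = (LINT x|lborel. (b - a) *\<^sub>R (indicator z x *\<^sub>R x))"
    using ab by simp
  also have "\<dots> = (b - a) *\<^sub>R (LINT x|lborel. indicator z x *\<^sub>R x)"
    by (rule integral_scaleR_right)
  finally show ?thesis
    using ab vol by (simp add: centroid_def set_lebesgue_integral_def)
qed

lemma Inf_height_prism: "z \<noteq> {} \<Longrightarrow> a \<le> b \<Longrightarrow> Inf (snd ` (z \<times> {a..b})) = (a :: real)"
  by simp

text \<open>The vertical factor is the interval in which the line processes have mean count given by
  the marks.\<close>

lemma unit_cube_prod: "(x, t) \<in> unit_cube \<longleftrightarrow> x \<in> unit_cube \<and> t \<in> {0..<(1::real)}"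
  by (auto simp: unit_cube_def Basis_prod_def)

text \<open>Only bounded prisms are listed, so being a tessellation forces a point of the column
  above any height: a cell covering a higher point over the interior of \<open>z\<close> must stand
  on \<open>z\<close>, and its top is such a point. Local finiteness then yields a lowest
  one.\<close>

lemma column_next_point:
  fixes T :: "'a::euclidean_space set set"
  assumes T: "tessellation T" and W: "tessellation (column_tessellation T \<phi>)"
    and fin: "\<And>a b. finite (\<phi> z \<inter> {a..b})" and z: "z \<in> T"
  obtains b where "b \<in> \<phi> z" "a < b" "\<phi> z \<inter> {a<..<b} = {}"
proof -
  obtain x where x: "x \<in> interior z" using is_cellD(2)[OF tessellationD(1)[OF T z]] by blast
  \<comment> \<open>Height \<open>a + 1\<close> guarantees that the top of this cell is strictly
    above \<open>a\<close>.\<close>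
  obtain v where v: "v \<in> column_tessellation T \<phi>" "(x, a + 1) \<in> v"
    using tessellationD(2)[OF W] by blast
  from v(1) obtain z' a' b' where v': "v = z' \<times> {a'..b'}" "z' \<in> T" "b' \<in> \<phi> z'"
    unfolding column_tessellation_def by blast
  \<comment> \<open>\<open>z'\<close> is the closure of its interior, so the open set
    \<open>interior z\<close> meets \<open>interior z'\<close>, and the two cells coincide.\<close>
  have "x \<in> interior z \<inter> closure (interior z')"
    using x v(2) v'(1) is_cellD(9)[OF tessellationD(1)[OF T v'(2)]] by simp
  then obtain y where "y \<in> interior z" "y \<in> interior z'"
    using open_Int_closure_eq_empty[of "interior z" "interior z'"] by auto
  then have "z' = z" using tessellationD(3)[OF T] z v'(2) by blast
  define S where "S = \<phi> z \<inter> {a<..b'}"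
  have "finite S" using fin[of a b'] by (rule finite_subset[rotated]) (auto simp: S_def)
  have "b' \<in> S" using v(2) v' \<open>z' = z\<close> by (auto simp: S_def)
  then have "Min S \<in> S" using \<open>finite S\<close> by (intro Min_in) auto
  show ?thesis
  proof (rule that)
    show "Min S \<in> \<phi> z" "a < Min S" using \<open>Min S \<in> S\<close> by (auto simp: S_def)
    show "\<phi> z \<inter> {a<..<Min S} = {}"
    proof (rule equals0I)
      fix c assume c: "c \<in> \<phi> z \<inter> {a<..<Min S}"
      then have "c \<in> S" using \<open>Min S \<in> S\<close> by (auto simp: S_def)
      then show False using c Min_le[OF \<open>finite S\<close>, of c] by auto
    qed
  qed
qed

text \<open>A prism corresponds to its cross-section and bottom height, because the top is the next
  point of the column. So prisms with reference point in the cube match pairs of a cell and a point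
  of its line.\<close>

lemma column_count:
  fixes T :: "'a::euclidean_space set set"
  assumes T: "tessellation T" and W: "tessellation (column_tessellation T \<phi>)"
    and fin: "\<And>z a b. z \<in> T \<Longrightarrow> finite (\<phi> z \<inter> {a..b})"
  shows "(\<integral>\<^sup>+v. indicator unit_cube (fst (centroid v), Inf (snd ` v)) \<partial>count_space (column_tessellation T \<phi>)) =
    (\<integral>\<^sup>+z. indicator unit_cube (centroid z) * emeasure (count_space UNIV) (\<phi> z \<inter> {0..<1}) \<partial>count_space T)"
proof -
  let ?W = "column_tessellation T \<phi>"
  define p where "p v = (fst (centroid v), Inf (snd ` v))" for v :: "('a \<times> real) set"
  define V where "V = {v \<in> ?W. p v \<in> unit_cube}"
  define S where "S = {(z, a). z \<in> T \<and> centroid z \<in> unit_cube \<and> a \<in> \<phi> z \<inter> {0..<1}}"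
  have cell: "is_cell z" "z \<noteq> {}" if "z \<in> T" for z
    using tessellationD(1)[OF T that] is_cellD(7) by auto
  have p: "p (z \<times> {a..b}) = (centroid z, a)" if "z \<in> T" "a < b" for z a b
    using that cell[of z] by (simp add: p_def fst_centroid_prism Inf_height_prism del: snd_image_times)
  have "bij_betw (\<lambda>v. (fst ` v, Inf (snd ` v))) V S"
  proof (rule bij_betw_imageI)
    show "inj_on (\<lambda>v. (fst ` v, Inf (snd ` v))) V"
    proof (rule inj_onI)
      fix v w assume "v \<in> V" "w \<in> V" and eq: "(fst ` v, Inf (snd ` v)) = (fst ` w, Inf (snd ` w))"
      then obtain z a b z' a' b' where
        v: "v = z \<times> {a..b}" "z \<in> T" "b \<in> \<phi> z" "a < b" "\<phi> z \<inter> {a<..<b} = {}" and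
        w: "w = z' \<times> {a'..b'}" "z' \<in> T" "b' \<in> \<phi> z'" "a' < b'" "\<phi> z' \<inter> {a'<..<b'} = {}"
        unfolding V_def column_tessellation_def by blast
      have "z = z'" "a = a'" using eq v w cell by (simp_all add: v(1) w(1))
      \<comment> \<open>If the tops differed, the lower one would be a point strictly inside the
        other gap.\<close>
      moreover from this v w have "b = b'" by (cases b b' rule: linorder_cases) auto
      ultimately show "v = w" using v(1) w(1) by simp
    qed
    show "(\<lambda>v. (fst ` v, Inf (snd ` v))) ` V = S"
    proof (intro set_eqI iffI)
      fix y assume "y \<in> (\<lambda>v. (fst ` v, Inf (snd ` v))) ` V"
      then obtain v where "v \<in> V" "y = (fst ` v, Inf (snd ` v))" by blast
      moreover from \<open>v \<in> V\<close> obtain z a b where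
        "v = z \<times> {a..b}" "z \<in> T" "a \<in> \<phi> z" "a < b"
        unfolding V_def column_tessellation_def by blast
      ultimately show "y \<in> S"
        using p[of z a b] cell[of z] by (auto simp: V_def S_def unit_cube_prod)
    next
      fix y assume "y \<in> S"
      then obtain z a where y: "y = (z, a)" and za: "z \<in> T" "centroid z \<in> unit_cube" "a \<in> \<phi> z" "a \<in> {0..<1}"
        by (auto simp: S_def)
      obtain b where b: "b \<in> \<phi> z" "a < b" "\<phi> z \<inter> {a<..<b} = {}"
        using column_next_point[OF T W fin[OF za(1)] za(1)] by blast
      have "z \<times> {a..b} \<in> V"
        unfolding V_def using za b p[OF za(1) b(2)] by (auto simp: column_tessellation_def unit_cube_prod)
      moreover have "y = (fst ` (z \<times> {a..b}), Inf (snd ` (z \<times> {a..b})))"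
        using y b(2) cell[OF za(1)] by simp
      ultimately show "y \<in> (\<lambda>v. (fst ` v, Inf (snd ` v))) ` V" by blast
    qed
  qed
  then have bij: "(\<integral>\<^sup>+v. 1 \<partial>count_space V) = (\<integral>\<^sup>+y. (1 :: ennreal) \<partial>count_space S)"
    by (rule nn_integral_bij_count_space)
  have "(\<integral>\<^sup>+v. indicator unit_cube (p v) \<partial>count_space ?W) = (\<integral>\<^sup>+v. 1 \<partial>count_space V)"
    unfolding V_def nn_integral_count_space_Collect by simp
  also have "\<dots> = (\<integral>\<^sup>+y. indicator S y \<partial>count_space UNIV)"
    unfolding bij by (simp add: emeasure_count_space)
  \<comment> \<open>The pairs are counted cell by cell.\<close>
  also have "\<dots> = (\<integral>\<^sup>+z. (\<integral>\<^sup>+a. indicator S (z, a) \<partial>count_space UNIV) \<partial>count_space UNIV)"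
    by (rule nn_integral_fst_count_space[symmetric])
  also have "\<dots> = (\<integral>\<^sup>+z. (\<integral>\<^sup>+a. indicator T z * indicator unit_cube (centroid z) * 
      indicator (\<phi> z \<inter> {0..<1}) a \<partial>count_space UNIV) \<partial>count_space UNIV)"
    by (intro nn_integral_cong) (auto simp: S_def indicator_def)
  also have "\<dots> = (\<integral>\<^sup>+z. indicator unit_cube (centroid z) * emeasure (count_space UNIV) (\<phi> z \<inter> {0..<1}) \<partial>count_space T)"
    by (simp add: nn_integral_cmult nn_integral_count_space_indicator mult.assoc mult.commute)
  finally show ?thesis by (simp add: p_def)
qed

theorem theorem4p9:
  fixes M :: "'w measure"
    and Y' :: "'w \<Rightarrow> (real^2) set set"
    and Y :: "'w \<Rightarrow> ((real^2) \<times> real) set set"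
    and \<rho> :: "(real^2) set set \<Rightarrow> (real^2) set \<Rightarrow> real"
    and \<Phi> :: "'w \<Rightarrow> (real^2) set \<Rightarrow> real set"
  assumes "stationary_random_tessellation M Y'"
    and "0 < cell_intensity M Y'" and "cell_intensity M Y' < \<infinity>"
    and "cell_mark \<rho>"
    and "line_processes M Y' \<rho> \<Phi>"
    and "stationary_random_tessellation M Y"
    and "AE \<omega> in M. Y \<omega> = column_tessellation (Y' \<omega>) (\<Phi> \<omega>)"
    and "0 < cell_intensity M Y" and "cell_intensity M Y < \<infinity>"
  shows "typical_cell_mean M Y (\<lambda>_ z. emeasure lborel z) =
    1 / (cell_intensity M Y' * typical_cell_mean M Y' (\<lambda>T z. ennreal (\<rho> T z)))"
proof -
  note tess = stationary_random_tessellation_tessellation[OF assms(1)]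
    stationary_random_tessellation_tessellation[OF assms(6)]
  \<comment> \<open>For a prism, this is the point of the bottom facet below the centroid; it moves
    along with translations.\<close>
  let ?p = "\<lambda>v :: ((real^2) \<times> real) set. (fst (centroid v), Inf (snd ` v))"
  have "?p \<in> borel_measurable cell_space"
    unfolding borel_prod[symmetric]
    by (intro measurable_Pair measurable_Inf_height measurable_compose[OF measurable_centroid])
       (simp add: borel_prod[symmetric])
  then have "cell_intensity M Y =
      (\<integral>\<^sup>+\<omega>. (\<integral>\<^sup>+v. indicator unit_cube (?p v) \<partial>count_space (Y \<omega>)) \<partial>M)"
    by (intro cell_intensity_eq_reference_point[OF assms(6)])
       (auto simp: centroid_translate Inf_height_translate prod_eq_iff)
  also have "\<dots> = (\<integral>\<^sup>+\<omega>. (\<integral>\<^sup>+z. indicator unit_cube (centroid z) *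
      emeasure (count_space UNIV) (\<Phi> \<omega> z \<inter> {0..<1}) \<partial>count_space (Y' \<omega>)) \<partial>M)"
  proof (rule nn_integral_cong_AE)
    show "AE \<omega> in M. (\<integral>\<^sup>+v. indicator unit_cube (?p v) \<partial>count_space (Y \<omega>)) =
      (\<integral>\<^sup>+z. indicator unit_cube (centroid z) * emeasure (count_space UNIV) (\<Phi> \<omega> z \<inter> {0..<1}) \<partial>count_space (Y' \<omega>))"
      \<comment> \<open>The column structure holds almost surely, which suffices under the
        integral.\<close>
      using assms(7) AE_space
    proof eventually_elim
      case (elim \<omega>)
      then show ?case
        using column_count[of "Y' \<omega>" "\<Phi> \<omega>"] tess[of \<omega>]
          line_processes_locally_finite[OF assms(1,5) \<open>\<omega> \<in> space M\<close>] by simp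
    qed
  qed
  also have "\<dots> = (\<integral>\<^sup>+\<omega>. (\<integral>\<^sup>+z. indicator unit_cube (centroid z) * ennreal (\<rho> (Y' \<omega>) z) \<partial>count_space (Y' \<omega>)) \<partial>M)"
    by (rule line_process_intensity_sum[OF assms(1,4,5)])
       (auto intro!: measurable_compose[OF measurable_centroid])
  \<comment> \<open>A positive and finite planar intensity may be cancelled against the denominator
    of the Palm mean.\<close>
  also have "\<dots> = cell_intensity M Y' * typical_cell_mean M Y' (\<lambda>T z. ennreal (\<rho> T z))"
    using assms(2,3) unfolding typical_cell_mean_def nn_integral_count_space_Collect
    by (simp add: ennreal_times_divide mult.commute[of "cell_intensity M Y'"] mult_divide_eq_ennreal)
  \<comment> \<open>The numerator of the mean volume is 1 by \<open>stationary_volume_sum\<close>,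
    which leaves the reciprocal of the intensity just computed.\<close>
  finally show ?thesis
    by (simp add: typical_cell_mean_def stationary_volume_sum[OF assms(6)])
qed

end
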